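(* Let $n\ge 1$ and let $g, W:\mathbb{R}^n\to(0,+\infty)$ be $\mathcal C^1$ positive functions such that $\int_{\mathbb{R}^n} g^{-n}\,dx=\int_{\mathbb{R}^n} W^{-n}\,dx=1$. Assume moreover that there exists a constant $C>0$ such that for all $x\in\mathbb{R}^n$, $$W(x)\ge \frac1C\,\frac{|x|^2}{2},$$ $$\frac1C(|x|^2+1)\le g(x)\le C(|x|^2+1)\quad\text{and}\quad |\nabla g(x)|\le C(|x|+1).$$ Then $$\int_{\mathbb{R}^n}\frac{W^*(\nabla g)}{g^{n+1}}\,dx\ge 0.$$ Moreover, if $W$ is a $\mathcal C^1$, positive and strictly convex function on $\mathbb{R}^n$ such that $\int W^{-n}\,dx=1$ and, for some constant $C>0$, $W(x)\ge \frac1C\frac{|x|^2}{2}$ for all $x\in\mathbb{R}^n$, then the inequality $\int_{\mathbb{R}^n}\frac{W^*(\nabla g)}{g^{n+1}}\,dx\ge 0$ is an equality for $g=W$, that is, $$\int_{\mathbb{R}^n}\frac{W^*(\nabla W)}{W^{n+1}}\,dx=0.$$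
   Context: For a function $\psi$ on $\mathbb{R}^n$, $\psi^*$ denotes its Legendre transform: $\psi^*(y)=\sup_{x\in\mathbb{R}^n}\{y\cdot x-\psi(x)\}\in(-\infty,+\infty]$, $y\in\mathbb{R}^n$. Integrals are with respect to Lebesgue measure on $\mathbb{R}^n$ and $|\cdot|$ is the Euclidean norm. *)

theory Defs
  imports "HOL-Analysis.Analysis"
begin

definition grad :: "('a::euclidean_space \<Rightarrow> real) \<Rightarrow> 'a \<Rightarrow> 'a" where
  "grad f x = (THE D. GDERIV f x :> D)"

text \<open>Frechet differentiability is required at every point, so \<^const>\<open>grad\<close> is a genuine gradient
  (see \<open>differentiable_GDERIV_grad\<close> below).\<close>

definition C1 :: "('a::euclidean_space \<Rightarrow> real) \<Rightarrow> bool" where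
  "C1 f \<longleftrightarrow> (\<forall>x. f differentiable (at x)) \<and> continuous_on UNIV (grad f)"

definition strictly_convex :: "('a::real_vector \<Rightarrow> real) \<Rightarrow> bool" where
  "strictly_convex f \<longleftrightarrow>
     (\<forall>x y t. x \<noteq> y \<longrightarrow> 0 < t \<longrightarrow> t < 1 \<longrightarrow>
        f ((1 - t) *\<^sub>R x + t *\<^sub>R y) < (1 - t) * f x + t * f y)"

definition legendre :: "('a::euclidean_space \<Rightarrow> real) \<Rightarrow> 'a \<Rightarrow> ereal" where
  "legendre \<psi> y = (SUP x. ereal (y \<bullet> x - \<psi> x))"

lemma grad_eqI:
  fixes f :: "'a::euclidean_space \<Rightarrow> real"
  assumes "GDERIV f x :> D"
  shows "grad f x = D"
proof -
  have "E = D" if "GDERIV f x :> E" for E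
  proof -
    have "(\<lambda>h. h \<bullet> E) = (\<lambda>h. h \<bullet> D)"
      using that assms unfolding gderiv_def by (rule has_derivative_unique)
    then have "h \<bullet> E = h \<bullet> D" for h
      by (rule fun_cong)
    then show ?thesis
      using vector_eq_rdot[of E D] by (simp add: inner_commute)
  qed
  with assms show ?thesis
    unfolding grad_def by (rule the_equality)
qed

lemma differentiable_GDERIV_grad:
  fixes f :: "'a::euclidean_space \<Rightarrow> real"
  assumes "f differentiable (at x)"
  shows "GDERIV f x :> grad f x"
proof -
  obtain f' where f': "(f has_derivative f') (at x)"
    using assms unfolding differentiable_def by blast
  interpret bounded_linear f'
    using f' by (rule has_derivative_bounded_linear)
  have "f' h = h \<bullet> adjoint f' 1" for h
    using adjoint_works[OF linear_axioms, of h 1] by simp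
  then have "f' = (\<lambda>h. h \<bullet> adjoint f' 1)"
    by (rule ext)
  with f' have "GDERIV f x :> adjoint f' 1"
    unfolding gderiv_def by (rule has_derivative_eq_rhs)
  then show ?thesis
    by (simp only: grad_eqI)
qed

end

theory Submission
  imports Defs
begin

text \<open>
  Write \<open>n\<close> for the dimension. The inequality is the derivative at \<open>t = 0\<close> of a Borell-Brascamp-Lieb
  inequality along the Hopf-Lax semigroup \<open>Q\<^sub>t g x = (INF y. g (x - t y) + t W y)\<close>.

  In its extremal case, the Borell-Brascamp-Lieb inequality says: if \<open>c (x + y) \<le> a x + b y\<close> for positive
  functions, then \<open>\<integral> c\<^sup>-\<^sup>n \<ge> min (\<integral> a\<^sup>-\<^sup>n) (\<integral> b\<^sup>-\<^sup>n)\<close>. With \<open>a = g\<close>, \<open>b y = t W (y / t)\<close> and \<open>c = Q\<^sub>t g\<close>, both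
  integrals on the right are 1, because the scaling of \<open>b\<close> preserves \<open>\<integral> b\<^sup>-\<^sup>n\<close>. Hence \<open>\<integral> (Q\<^sub>t g)\<^sup>-\<^sup>n \<ge> 1\<close> for
  all small \<open>t > 0\<close>, with equality at \<open>t = 0\<close> (\<open>hopf_lax_integral_ge\<close>). Since
  \<open>(Q\<^sub>t g - g) / t \<rightarrow> - W\<^sup>* (\<nabla>g)\<close>, the difference quotients of \<open>(Q\<^sub>t g)\<^sup>-\<^sup>n\<close> tend to \<open>n W\<^sup>* (\<nabla>g) / g\<^sup>n\<^sup>+\<^sup>1\<close>. The growth
  hypotheses bound \<open>(Q\<^sub>t g - g) / t\<close> by a multiple of \<open>g\<close>, so that a multiple of the integrable function \<open>g\<^sup>-\<^sup>n\<close>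
  dominates the quotients, and the limit has a nonnegative integral (\<open>comparison_nonneg\<close>).

  The Borell-Brascamp-Lieb inequality itself is proved by induction on the number of coordinates. It is phrased
  with the reciprocals \<open>f = 1 / a\<close>, \<open>g = 1 / b\<close>, \<open>h = 1 / c\<close>, for which the hypothesis becomes
  \<open>h (x + y) \<ge> f x g y / (f x + g y)\<close>; a function may then vanish, and cutting off to a box makes sense. On the
  line, comparing the superlevel sets of \<open>f / sup f\<close>, \<open>g / sup g\<close> and \<open>h\<close> by the Brunn-Minkowski inequality
  \<open>\<bar>A + B\<bar> \<ge> \<bar>A\<bar> + \<bar>B\<bar>\<close> gives \<open>\<integral> h\<^sup>k \<ge> \<theta>\<^sup>k \<integral> f\<^sup>k + (1 - \<theta>)\<^sup>k \<integral> g\<^sup>k\<close> with \<open>\<theta> = sup g / (sup f + sup g)\<close>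
  (\<open>bbl_real_weighted\<close>). By convexity the right-hand side is at least a parallel sum of the \<open>(k-1)\<close>-st roots of the two
  integrals, raised to the power \<open>k - 1\<close> (\<open>parallel_sum_power_le\<close>). So integrating out one coordinate reproduces the
  hypothesis with one dimension less, and \<open>k = 1\<close> is a convex combination, which dominates the minimum.

  For \<open>g = W\<close> convex, \<open>W\<^sup>* (\<nabla>W x) = x \<bullet> \<nabla>W x - W x\<close>, and
  \<open>- n (x \<bullet> \<nabla>W x - W x) / W x\<^sup>n\<^sup>+\<^sup>1\<close> is the derivative at \<open>r = 1\<close> of \<open>r\<^sup>n W (r x)\<^sup>-\<^sup>n\<close>, a dilation that
  preserves the integral. So the integral of the derivative is 0. Integrating over \<open>r \<in> {1..2}\<close> and exchanging the
  integrals turns this into a proof, in which convexity supplies the one-sided bound that Tonelli's theorem needs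
  (\<open>convex_equality\<close>).
\<close>

section \<open>Parallel sums and the Brunn-Minkowski inequality on the line\<close>

text \<open>
  \<open>1 / (1 / u + 1 / v)\<close>, extended by 0 as soon as one argument is 0 (division by 0 being 0 covers \<open>u = v = 0\<close>).
\<close>

definition parallel_sum :: "real \<Rightarrow> real \<Rightarrow> real" where
  "parallel_sum u v = u * v / (u + v)"

lemma parallel_sum_nonneg: "0 \<le> u \<Longrightarrow> 0 \<le> v \<Longrightarrow> 0 \<le> parallel_sum u v"
  by (simp add: parallel_sum_def)

lemma parallel_sum_0 [simp]: "parallel_sum 0 v = 0" "parallel_sum u 0 = 0"
  by (simp_all add: parallel_sum_def)

lemma parallel_sum_le:
  assumes "0 \<le> u" "0 \<le> v"
  shows "parallel_sum u v \<le> u" "parallel_sum u v \<le> v"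
proof -
  have "u * v \<le> u * (u + v)" "u * v \<le> v * (u + v)"
    using assms by (simp_all add: distrib_left mult.commute)
  then show "parallel_sum u v \<le> u" "parallel_sum u v \<le> v"
    using assms unfolding parallel_sum_def
    by (cases "u + v = 0"; auto simp: divide_le_eq)+
qed

lemma parallel_sum_mono:
  assumes "0 \<le> u" "u \<le> u'" "0 \<le> v" "v \<le> v'"
  shows "parallel_sum u v \<le> parallel_sum u' v'"
proof (cases "u = 0 \<or> v = 0")
  case True
  then show ?thesis using assms parallel_sum_nonneg[of u' v'] by auto
next
  case False
  then have p: "0 < u" "0 < v" "0 < u'" "0 < v'" using assms by auto
  have e: "parallel_sum a b = 1 / (1 / a + 1 / b)" if "0 < a" "0 < b" for a b
    using that by (simp add: parallel_sum_def field_simps)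
  have "1 / u' + 1 / v' \<le> 1 / u + 1 / v"
    using p assms by (intro add_mono divide_left_mono) auto
  then show ?thesis
    unfolding e[OF p(1,2)] e[OF p(3,4)] using p
    by (intro divide_left_mono) (auto intro!: mult_pos_pos add_pos_pos)
qed

lemma parallel_sum_strict_mono:
  assumes "0 < u" "u < u'" "0 < v" "v < v'"
  shows "parallel_sum u v < parallel_sum u' v'"
proof -
  have e: "parallel_sum a b = 1 / (1 / a + 1 / b)" if "0 < a" "0 < b" for a b
    using that by (simp add: parallel_sum_def field_simps)
  have "1 / u' + 1 / v' < 1 / u + 1 / v"
    using assms by (intro add_strict_mono divide_strict_left_mono) auto
  then show ?thesis
    using assms
    by (subst (1 2) e) (auto intro!: divide_strict_left_mono mult_pos_pos add_pos_pos)
qed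

lemma parallel_sum_scale: "parallel_sum (c * u) (c * v) = c * parallel_sum u v"
  by (cases "c = 0") (simp_all add: parallel_sum_def distrib_left[symmetric])

lemma power_jensen:
  fixes x y \<theta> :: real
  assumes "0 \<le> x" "0 \<le> y" "0 \<le> \<theta>" "\<theta> \<le> 1"
  shows "(\<theta> * x + (1 - \<theta>) * y) ^ m \<le> \<theta> * x ^ m + (1 - \<theta>) * y ^ m"
proof -
  have "convex_on {0::real..} (\<lambda>x. x ^ m)"
    by (cases "even m")
       (auto intro: convex_power_odd convex_on_subset[OF convex_power_even])
  from convex_onD[OF this, of "1 - \<theta>" x y] show ?thesis
    using assms by (simp add: algebra_simps)
qed

text \<open>
  With \<open>p = \<theta> u\<close> and \<open>q = (1 - \<theta>) v\<close> the right-hand side is \<open>\<theta> p\<^sup>m + (1 - \<theta>) q\<^sup>m\<close>, at least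
  \<open>(\<theta> p + (1 - \<theta>) q)\<^sup>m\<close> by convexity; and \<open>\<theta>\<^sup>2 u + (1 - \<theta>)\<^sup>2 v\<close> has the parallel sum as its minimum over \<open>\<theta>\<close>.
\<close>

lemma parallel_sum_power_le:
  fixes u v \<theta> :: real
  assumes "0 \<le> u" "0 \<le> v" "0 \<le> \<theta>" "\<theta> \<le> 1"
  shows "parallel_sum u v ^ m \<le> \<theta> ^ Suc m * u ^ m + (1 - \<theta>) ^ Suc m * v ^ m"
proof -
  have "parallel_sum u v \<le> \<theta> * (\<theta> * u) + (1 - \<theta>) * ((1 - \<theta>) * v)"
  proof (cases "u = 0 \<or> v = 0")
    case True
    then show ?thesis using assms by auto
  next
    case False
    then have p: "0 < u + v" using assms by simp
    have "0 \<le> (\<theta> * u - (1 - \<theta>) * v)\<^sup>2" by simp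
    then have "u * v \<le> (\<theta> * (\<theta> * u) + (1 - \<theta>) * ((1 - \<theta>) * v)) * (u + v)"
      by (simp add: power2_eq_square algebra_simps)
    then show ?thesis unfolding parallel_sum_def by (simp only: pos_divide_le_eq[OF p])
  qed
  then have "parallel_sum u v ^ m \<le> (\<theta> * (\<theta> * u) + (1 - \<theta>) * ((1 - \<theta>) * v)) ^ m"
    using assms by (intro power_mono parallel_sum_nonneg) auto
  also have "\<dots> \<le> \<theta> * (\<theta> * u) ^ m + (1 - \<theta>) * ((1 - \<theta>) * v) ^ m"
    using assms by (intro power_jensen) auto
  finally show ?thesis by (simp add: power_mult_distrib)
qed

text \<open>
  The translates of \<open>K\<close> by the least element of \<open>L\<close> and of \<open>L\<close> by the greatest element of \<open>K\<close> both lie in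
  the sum set and share a single point.
\<close>

lemma brunn_minkowski_compact:
  fixes K L :: "real set"
  assumes "compact K" "compact L" "K \<noteq> {}" "L \<noteq> {}" "S \<in> sets borel"
    and sum: "\<And>x y. x \<in> K \<Longrightarrow> y \<in> L \<Longrightarrow> x + y \<in> S"
  shows "emeasure lebesgue K + emeasure lebesgue L \<le> emeasure lebesgue S"
proof -
  obtain k where k: "k \<in> K" "\<And>x. x \<in> K \<Longrightarrow> x \<le> k"
    using compact_attains_sup[OF assms(1,3)] by blast
  obtain l where l: "l \<in> L" "\<And>x. x \<in> L \<Longrightarrow> l \<le> x"
    using compact_attains_inf[OF assms(2,4)] by blast
  let ?K = "(+) l ` K" and ?L = "(+) k ` L"
  have m: "K \<in> lmeasurable" "L \<in> lmeasurable" "?K \<in> lmeasurable" "?L \<in> lmeasurable"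
    using assms by (auto intro!: lmeasurable_compact compact_translation)
  have "?K \<inter> ?L \<subseteq> {k + l}"
    using k l by fastforce
  then have n: "negligible (?K \<inter> ?L)"
    by (metis negligible_sing negligible_subset)
  have "measure lebesgue K + measure lebesgue L = measure lebesgue (?K \<union> ?L)"
    using n m by (simp add: measure_Un3_negligible measure_Un3 measure_translation negligible_imp_measure0)
  also have "ennreal \<dots> = emeasure lebesgue (?K \<union> ?L)"
    using m by (simp add: emeasure_eq_measure2 fmeasurable.Un)
  also have "\<dots> \<le> emeasure lebesgue S"
    using k l sum[of _ l] sum[of k] assms(5)
    by (intro emeasure_mono) (auto simp: add.commute[of l])
  finally show ?thesis
    using m by (simp add: emeasure_eq_measure2)
qed

text \<open>
  Stated with a superset \<open>S\<close> of the sum set, because the sum of two Borel sets need not be Borel.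
\<close>

lemma brunn_minkowski_real:
  fixes A B :: "real set"
  assumes "A \<in> sets borel" "B \<in> sets borel" "bounded A" "bounded B" "A \<noteq> {}" "B \<noteq> {}" "S \<in> sets borel"
    and sum: "\<And>x y. x \<in> A \<Longrightarrow> y \<in> B \<Longrightarrow> x + y \<in> S"
  shows "emeasure lborel A + emeasure lborel B \<le> emeasure lborel S"
proof -
  have approx: "\<exists>K. compact K \<and> K \<subseteq> X \<and> K \<noteq> {} \<and> emeasure lebesgue X \<le> emeasure lebesgue K + ennreal e"
    if X: "X \<in> sets borel" "bounded X" "X \<noteq> {}" "0 < e" for X :: "real set" and e
  proof -
    have XL: "X \<in> sets lebesgue" using X by simp
    obtain T where T: "closed T" "T \<subseteq> X" "X - T \<in> lmeasurable" "emeasure lebesgue (X - T) < ennreal e"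
      using sets_lebesgue_inner_closed[OF XL \<open>0 < e\<close>] .
    obtain z where z: "z \<in> X" using X by auto
    have cT: "compact (insert z T)"
      using T X by (intro compact_insert) (auto simp: compact_eq_bounded_closed intro: bounded_subset)
    have "emeasure lebesgue X \<le> emeasure lebesgue (insert z T \<union> (X - T))"
      using T X cT by (intro emeasure_mono) (auto intro: fmeasurableD lmeasurable_compact)
    also have "\<dots> \<le> emeasure lebesgue (insert z T) + emeasure lebesgue (X - T)"
      using T cT by (intro emeasure_subadditive) (auto intro: fmeasurableD lmeasurable_compact)
    also have "\<dots> \<le> emeasure lebesgue (insert z T) + ennreal e"
      using T by (intro add_left_mono) auto
    finally show ?thesis using cT z T by (intro exI[of _ "insert z T"]) auto
  qed
  have "emeasure lebesgue A + emeasure lebesgue B \<le> emeasure lebesgue S"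
  proof (rule ennreal_le_epsilon)
    fix e :: real assume e: "0 < e"
    obtain K where K: "compact K" "K \<subseteq> A" "K \<noteq> {}" "emeasure lebesgue A \<le> emeasure lebesgue K + ennreal (e/2)"
      using approx[of A "e/2"] assms e by auto
    obtain L where L: "compact L" "L \<subseteq> B" "L \<noteq> {}" "emeasure lebesgue B \<le> emeasure lebesgue L + ennreal (e/2)"
      using approx[of B "e/2"] assms e by auto
    have "emeasure lebesgue A + emeasure lebesgue B
        \<le> (emeasure lebesgue K + ennreal (e/2)) + (emeasure lebesgue L + ennreal (e/2))"
      using K L by (intro add_mono) auto
    also have "\<dots> = (emeasure lebesgue K + emeasure lebesgue L) + ennreal e"
      using e by (simp add: ac_simps flip: ennreal_plus)
    also have "\<dots> \<le> emeasure lebesgue S + ennreal e"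
      using K L assms by (intro add_right_mono brunn_minkowski_compact) auto
    finally show "emeasure lebesgue A + emeasure lebesgue B \<le> emeasure lebesgue S + ennreal e" .
  qed
  then show ?thesis using assms by simp
qed

section \<open>The Borell-Brascamp-Lieb inequality on the line\<close>

text \<open>
  Integrate \<open>c\<^sup>m\<^sup>+\<^sup>1 = \<integral>\<^sub>0\<^sup>c (m + 1) l\<^sup>m dl\<close> at \<open>c = min (u x) 1\<close> over \<open>x\<close> and exchange the integrals. Truncating at 1
  keeps only the levels \<open>l < 1\<close>, at which the superlevel sets of a function with supremum 1 are nonempty.
\<close>

lemma layer_cake_power:
  fixes u :: "real \<Rightarrow> real"
  assumes [measurable]: "u \<in> borel_measurable borel" and nonneg: "\<And>x. 0 \<le> u x"
  shows "(\<integral>\<^sup>+x. ennreal (min (u x) 1 ^ Suc m) \<partial>lborel) =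
    (\<integral>\<^sup>+l. ennreal (Suc m * l ^ m) * indicator {0<..<1} l * emeasure lborel {x. l < u x} \<partial>lborel)"
proof -
  have "(\<integral>\<^sup>+x. ennreal (min (u x) 1 ^ Suc m) \<partial>lborel)
      = (\<integral>\<^sup>+x. (\<integral>\<^sup>+l. ennreal (Suc m * l ^ m) * indicator {0<..<1} l * indicator {x. l < u x} x \<partial>lborel) \<partial>lborel)"
  proof (rule nn_integral_cong)
    fix x
    let ?c = "min (u x) 1"
    have "(\<integral>\<^sup>+l. ennreal (Suc m * l ^ m) * indicator {0<..<1} l * indicator {x. l < u x} x \<partial>lborel)
        = (\<integral>\<^sup>+l. ennreal (Suc m * l ^ m) * indicator {0..?c} l \<partial>lborel)"
    proof (rule nn_integral_cong_AE)
      have "AE l in lborel. l \<noteq> 0 \<and> l \<noteq> ?c"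
        using AE_lborel_singleton[of "0::real"] AE_lborel_singleton[of ?c] by eventually_elim simp
      then show "AE l in lborel. ennreal (Suc m * l ^ m) * indicator {0<..<1} l * indicator {x. l < u x} x
          = ennreal (Suc m * l ^ m) * indicator {0..?c} l"
        by eventually_elim (auto split: split_indicator)
    qed
    also have "\<dots> = ennreal (?c ^ Suc m - 0 ^ Suc m)"
      using nonneg DERIV_pow[of "Suc m"] by (intro nn_integral_FTC_Icc) (auto simp del: power_Suc)
    finally show "ennreal (?c ^ Suc m) =
        (\<integral>\<^sup>+l. ennreal (Suc m * l ^ m) * indicator {0<..<1} l * indicator {x. l < u x} x \<partial>lborel)"
      by simp
  qed
  also have "\<dots> = (\<integral>\<^sup>+l. (\<integral>\<^sup>+x. ennreal (Suc m * l ^ m) * indicator {0<..<1} l * indicator {x. l < u x} x \<partial>lborel) \<partial>lborel)"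
    by (rule lborel_pair.Fubini') measurable
  also have "\<dots> = (\<integral>\<^sup>+l. ennreal (Suc m * l ^ m) * indicator {0<..<1} l * emeasure lborel {x. l < u x} \<partial>lborel)"
    by (intro nn_integral_cong nn_integral_cmult_indicator) measurable
  finally show ?thesis .
qed

text \<open>
  Divide \<open>f\<close>, \<open>g\<close>, \<open>h\<close> by \<open>p = sup f\<close>, \<open>q = sup g\<close> and the parallel sum \<open>r\<close> of \<open>p\<close> and \<open>q\<close>. At each level in
  \<open>(0,1)\<close> the superlevel sets of the first two are nonempty and their sum lies in that of the third, so
  Brunn-Minkowski and the layer cake formula give \<open>\<integral> (h/r)\<^sup>k \<ge> \<integral> (f/p)\<^sup>k + \<integral> (g/q)\<^sup>k\<close> for \<open>k = m + 1\<close>. Then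
  \<open>r = \<theta> p = (1 - \<theta>) q\<close> for \<open>\<theta> = q / (p + q)\<close>.
\<close>

lemma bbl_real_weighted:
  fixes f g h :: "real \<Rightarrow> real"
  assumes meas[measurable]: "f \<in> borel_measurable borel" "g \<in> borel_measurable borel" "h \<in> borel_measurable borel"
    and nonneg: "\<And>x. 0 \<le> f x" "\<And>x. 0 \<le> g x" "\<And>x. 0 \<le> h x"
    and bound: "\<And>x. f x \<le> M" "\<And>x. g x \<le> M"
    and supp: "\<And>x. R < \<bar>x\<bar> \<Longrightarrow> f x = 0" "\<And>x. R < \<bar>x\<bar> \<Longrightarrow> g x = 0"
    and par: "\<And>x y. parallel_sum (f x) (g y) \<le> h (x + y)"
  obtains \<theta> where "0 \<le> \<theta>" "\<theta> \<le> 1"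
    "ennreal (\<theta> ^ Suc m) * (\<integral>\<^sup>+x. ennreal (f x ^ Suc m) \<partial>lborel)
      + ennreal ((1 - \<theta>) ^ Suc m) * (\<integral>\<^sup>+x. ennreal (g x ^ Suc m) \<partial>lborel)
      \<le> (\<integral>\<^sup>+x. ennreal (h x ^ Suc m) \<partial>lborel)"
proof -
  define p where "p = (SUP x. f x)"
  define q where "q = (SUP x. g x)"
  have bdd: "bdd_above (range f)" "bdd_above (range g)"
    using bound by (auto intro!: bdd_aboveI)
  have fp: "f x \<le> p" "g x \<le> q" for x
    unfolding p_def q_def by (auto intro!: cSUP_upper bdd)
  have pq: "0 \<le> p" "0 \<le> q"
    using fp[of 0] nonneg(1,2)[of 0] by auto
  consider "p = 0" | "q = 0" | "0 < p" "0 < q" using pq by fastforce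
  then show thesis
  proof cases
    case 1
    \<comment> \<open>A vanishing function gets the full weight: \<open>0\<^sup>k = 0\<close> removes the other one, as \<open>k\<close> is positive.\<close>
    then have "f x = 0" for x using fp(1)[of x] nonneg(1)[of x] by simp
    then show thesis by (intro that[of 1]) auto
  next
    case 2
    then have "g x = 0" for x using fp(2)[of x] nonneg(2)[of x] by simp
    then show thesis by (intro that[of 0]) auto
  next
    case 3
    define r where "r = parallel_sum p q"
    have r: "0 < r" using 3 by (simp add: r_def parallel_sum_def)
    let ?w = "\<lambda>l::real. ennreal (Suc m * l ^ m) * indicator {0<..<1} l"
    have norm: "(\<integral>\<^sup>+x. ennreal (u x ^ Suc m) \<partial>lborel)
        = ennreal (c ^ Suc m) * (\<integral>\<^sup>+x. ennreal (min (u x / c) 1 ^ Suc m) \<partial>lborel)"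
      if [measurable]: "u \<in> borel_measurable borel" and u: "\<And>x. 0 \<le> u x" "\<And>x. u x \<le> c" "0 < c"
      for u c
    proof -
      have "min (u x / c) 1 = u x / c" for x
        using u by (simp add: min_def)
      then have "ennreal (u x ^ Suc m) = ennreal (c ^ Suc m) * ennreal (min (u x / c) 1 ^ Suc m)" for x
        using u(1)[of x] \<open>0 < c\<close> by (simp add: power_divide flip: ennreal_mult del: power_Suc)
      then show ?thesis by (subst nn_integral_cmult[symmetric]) (simp_all del: power_Suc)
    qed
    have level: "emeasure lborel {x. l < f x / p} + emeasure lborel {x. l < g x / q}
        \<le> emeasure lborel {x. l < h x / r}" if l: "0 < l" "l < 1" for l
    proof (rule brunn_minkowski_real)
      show "{x. l < f x / p} \<in> sets borel" "{x. l < g x / q} \<in> sets borel" "{x. l < h x / r} \<in> sets borel"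
        by measurable
      have *: "{x. l < u x / c} \<subseteq> {- R..R}" if "\<And>x. R < \<bar>x\<bar> \<Longrightarrow> u x = 0" for u c
      proof
        fix x assume "x \<in> {x. l < u x / c}"
        then have "u x \<noteq> 0" using l by auto
        then have "\<bar>x\<bar> \<le> R" using that[of x] by linarith
        then show "x \<in> {- R..R}" by auto
      qed
      show "bounded {x. l < f x / p}" "bounded {x. l < g x / q}"
        using *[of f p] *[of g q] supp by (auto intro: bounded_subset[of "{- R..R}"])
      have "l * p < p" "l * q < q" using l 3 by auto
      then obtain x y where "l * p < f x" "l * q < g y"
        unfolding p_def q_def by (auto simp: less_cSUP_iff[OF _ bdd(1)] less_cSUP_iff[OF _ bdd(2)])
      then show "{x. l < f x / p} \<noteq> {}" "{x. l < g x / q} \<noteq> {}"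
        using 3 by (auto simp: less_divide_eq)
      fix x y assume "x \<in> {x. l < f x / p}" "y \<in> {x. l < g x / q}"
      then have "parallel_sum (l * p) (l * q) < parallel_sum (f x) (g y)"
        using l 3 by (intro parallel_sum_strict_mono) (auto simp: less_divide_eq)
      also have "\<dots> \<le> h (x + y)" by (rule par)
      finally show "x + y \<in> {x. l < h x / r}"
        using r by (simp add: parallel_sum_scale r_def[symmetric] less_divide_eq)
    qed
    define F where "F = (\<integral>\<^sup>+x. ennreal (min (f x / p) 1 ^ Suc m) \<partial>lborel)"
    define G where "G = (\<integral>\<^sup>+x. ennreal (min (g x / q) 1 ^ Suc m) \<partial>lborel)"
    define H where "H = (\<integral>\<^sup>+x. ennreal (min (h x / r) 1 ^ Suc m) \<partial>lborel)"
    have "F + G = (\<integral>\<^sup>+l. ?w l * emeasure lborel {x. l < f x / p} + ?w l * emeasure lborel {x. l < g x / q} \<partial>lborel)"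
      unfolding F_def G_def using 3 nonneg
      by (simp add: layer_cake_power nn_integral_add del: power_Suc)
    also have "\<dots> \<le> (\<integral>\<^sup>+l. ?w l * emeasure lborel {x. l < h x / r} \<partial>lborel)"
      using level by (intro nn_integral_mono) (auto split: split_indicator simp: mult_left_mono simp flip: distrib_left)
    also have "\<dots> = H"
      unfolding H_def using r nonneg by (simp add: layer_cake_power del: power_Suc)
    finally have FGH: "F + G \<le> H" .
    have "ennreal (r ^ Suc m) * H = (\<integral>\<^sup>+x. ennreal (r ^ Suc m) * ennreal (min (h x / r) 1 ^ Suc m) \<partial>lborel)"
      unfolding H_def by (rule nn_integral_cmult[symmetric]) measurable
    also have "\<dots> \<le> (\<integral>\<^sup>+x. ennreal (h x ^ Suc m) \<partial>lborel)"
    proof (rule nn_integral_mono)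
      fix x
      have "r * min (h x / r) 1 \<le> h x" "0 \<le> r * min (h x / r) 1"
        using r nonneg(3)[of x] by (auto simp: min_def divide_simps)
      then have "(r * min (h x / r) 1) ^ Suc m \<le> h x ^ Suc m" by (rule power_mono)
      then show "ennreal (r ^ Suc m) * ennreal (min (h x / r) 1 ^ Suc m) \<le> ennreal (h x ^ Suc m)"
        using r nonneg(3)[of x] by (simp add: power_mult_distrib ennreal_leI flip: ennreal_mult del: power_Suc)
    qed
    finally have H: "ennreal (r ^ Suc m) * H \<le> (\<integral>\<^sup>+x. ennreal (h x ^ Suc m) \<partial>lborel)" .
    define \<theta> where "\<theta> = q / (p + q)"
    have \<theta>: "0 \<le> \<theta>" "\<theta> \<le> 1" "\<theta> * p = r" "(1 - \<theta>) * q = r"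
      using 3 by (auto simp: \<theta>_def r_def parallel_sum_def field_simps)
    have e: "ennreal (\<theta> ^ Suc m) * ennreal (p ^ Suc m) = ennreal (r ^ Suc m)"
      "ennreal ((1 - \<theta>) ^ Suc m) * ennreal (q ^ Suc m) = ennreal (r ^ Suc m)"
      using \<theta> 3 by (simp_all flip: ennreal_mult power_mult_distrib del: power_Suc)
    have "ennreal (\<theta> ^ Suc m) * (\<integral>\<^sup>+x. ennreal (f x ^ Suc m) \<partial>lborel)
        + ennreal ((1 - \<theta>) ^ Suc m) * (\<integral>\<^sup>+x. ennreal (g x ^ Suc m) \<partial>lborel)
        = ennreal (r ^ Suc m) * (F + G)"
      using norm[of f p] norm[of g q] fp nonneg 3 e
      by (simp add: F_def G_def distrib_left del: power_Suc flip: mult.assoc)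
    also have "\<dots> \<le> (\<integral>\<^sup>+x. ennreal (h x ^ Suc m) \<partial>lborel)"
      using FGH H by (meson mult_left_mono order_trans zero_le)
    finally show thesis using \<theta> by (intro that[of \<theta>]) auto
  qed
qed

lemma bbl_real_min:
  fixes f g h :: "real \<Rightarrow> real"
  assumes "f \<in> borel_measurable borel" "g \<in> borel_measurable borel" "h \<in> borel_measurable borel"
    and "\<And>x. 0 \<le> f x" "\<And>x. 0 \<le> g x" "\<And>x. 0 \<le> h x"
    and "\<And>x. f x \<le> M" "\<And>x. g x \<le> M"
    and "\<And>x. R < \<bar>x\<bar> \<Longrightarrow> f x = 0" "\<And>x. R < \<bar>x\<bar> \<Longrightarrow> g x = 0"
    and "\<And>x y. parallel_sum (f x) (g y) \<le> h (x + y)"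
  shows "min (\<integral>\<^sup>+x. ennreal (f x) \<partial>lborel) (\<integral>\<^sup>+x. ennreal (g x) \<partial>lborel) \<le> (\<integral>\<^sup>+x. ennreal (h x) \<partial>lborel)"
proof -
  obtain \<theta> where \<theta>: "0 \<le> \<theta>" "\<theta> \<le> 1"
    "ennreal (\<theta> ^ Suc 0) * (\<integral>\<^sup>+x. ennreal (f x ^ Suc 0) \<partial>lborel)
      + ennreal ((1 - \<theta>) ^ Suc 0) * (\<integral>\<^sup>+x. ennreal (g x ^ Suc 0) \<partial>lborel)
      \<le> (\<integral>\<^sup>+x. ennreal (h x ^ Suc 0) \<partial>lborel)"
    using bbl_real_weighted[OF assms, where m = 0] by blast
  let ?F = "\<integral>\<^sup>+x. ennreal (f x) \<partial>lborel" and ?G = "\<integral>\<^sup>+x. ennreal (g x) \<partial>lborel"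
  have "min ?F ?G = (ennreal \<theta> + ennreal (1 - \<theta>)) * min ?F ?G"
    using \<theta> by (simp flip: ennreal_plus)
  also have "\<dots> \<le> ennreal \<theta> * ?F + ennreal (1 - \<theta>) * ?G"
    unfolding distrib_right by (intro add_mono mult_left_mono) auto
  finally show ?thesis using \<theta>(3) by simp
qed

text \<open>
  The inductive form: the \<open>m\<close>-th root of \<open>\<integral> f\<^sup>m\<^sup>+\<^sup>1\<close> over one coordinate satisfies the same hypothesis as \<open>f\<close>,
  now to be integrated with exponent \<open>m\<close> over the remaining coordinates.
\<close>

lemma bbl_real_root:
  fixes f g h :: "real \<Rightarrow> real"
  assumes bbl: "f \<in> borel_measurable borel" "g \<in> borel_measurable borel" "h \<in> borel_measurable borel"
    "\<And>x. 0 \<le> f x" "\<And>x. 0 \<le> g x" "\<And>x. 0 \<le> h x"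
    "\<And>x. f x \<le> M" "\<And>x. g x \<le> M"
    "\<And>x. R < \<bar>x\<bar> \<Longrightarrow> f x = 0" "\<And>x. R < \<bar>x\<bar> \<Longrightarrow> g x = 0"
    "\<And>x y. parallel_sum (f x) (g y) \<le> h (x + y)"
    and m: "0 < m"
    and F: "(\<integral>\<^sup>+x. ennreal (f x ^ Suc m) \<partial>lborel) = ennreal F" "0 \<le> F"
    and G: "(\<integral>\<^sup>+x. ennreal (g x ^ Suc m) \<partial>lborel) = ennreal G" "0 \<le> G"
    and H: "(\<integral>\<^sup>+x. ennreal (h x ^ Suc m) \<partial>lborel) = ennreal H" "0 \<le> H"
  shows "parallel_sum (root m F) (root m G) \<le> root m H"
proof -
  obtain \<theta> where \<theta>: "0 \<le> \<theta>" "\<theta> \<le> 1"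
    "ennreal (\<theta> ^ Suc m) * ennreal F + ennreal ((1 - \<theta>) ^ Suc m) * ennreal G \<le> ennreal H"
    using bbl_real_weighted[OF bbl, where m = m] unfolding F G H by blast
  have "parallel_sum (root m F) (root m G) ^ m \<le> \<theta> ^ Suc m * root m F ^ m + (1 - \<theta>) ^ Suc m * root m G ^ m"
    using \<theta> F G m by (intro parallel_sum_power_le) auto
  also have "\<dots> = \<theta> ^ Suc m * F + (1 - \<theta>) ^ Suc m * G"
    using m F G by simp
  also have "\<dots> \<le> H"
    using \<theta> F G H by (simp flip: ennreal_mult ennreal_plus del: power_Suc)
  finally have "root m (parallel_sum (root m F) (root m G) ^ m) \<le> root m H"
    using m by simp
  then show ?thesis
    using m F G by (simp add: real_root_power_cancel parallel_sum_nonneg)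
qed

section \<open>The Borell-Brascamp-Lieb inequality in several dimensions\<close>

interpretation lborel_product: product_sigma_finite "\<lambda>_::'i. lborel :: real measure"
  by standard

text \<open>
  Bounds and a common box keep all integrals finite, so that roots of slice integrals are real numbers; both
  properties pass to the slices. They are required of \<open>h\<close> too, whose slice integrals could otherwise be infinite.
\<close>

lemma bbl_PiM:
  fixes f g h :: "('i \<Rightarrow> real) \<Rightarrow> real"
  defines "P \<equiv> \<lambda>I::'i set. Pi\<^sub>M I (\<lambda>_. lborel :: real measure)"
  assumes "finite I" "0 \<le> M" "0 \<le> R"
    and "f \<in> borel_measurable (P I)" "g \<in> borel_measurable (P I)" "h \<in> borel_measurable (P I)"
    and "\<And>x. x \<in> space (P I) \<Longrightarrow> 0 \<le> f x" "\<And>x. x \<in> space (P I) \<Longrightarrow> 0 \<le> g x" "\<And>x. x \<in> space (P I) \<Longrightarrow> 0 \<le> h x"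
    and "\<And>x. x \<in> space (P I) \<Longrightarrow> f x \<le> M" "\<And>x. x \<in> space (P I) \<Longrightarrow> g x \<le> M" "\<And>x. x \<in> space (P I) \<Longrightarrow> h x \<le> M"
    and "\<And>x i. x \<in> space (P I) \<Longrightarrow> i \<in> I \<Longrightarrow> R < \<bar>x i\<bar> \<Longrightarrow> f x = 0"
      "\<And>x i. x \<in> space (P I) \<Longrightarrow> i \<in> I \<Longrightarrow> R < \<bar>x i\<bar> \<Longrightarrow> g x = 0"
      "\<And>x i. x \<in> space (P I) \<Longrightarrow> i \<in> I \<Longrightarrow> R < \<bar>x i\<bar> \<Longrightarrow> h x = 0"
    and "\<And>x y. x \<in> space (P I) \<Longrightarrow> y \<in> space (P I) \<Longrightarrow> parallel_sum (f x) (g y) \<le> h (\<lambda>i\<in>I. x i + y i)"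
  shows "min (\<integral>\<^sup>+x. ennreal (f x ^ card I) \<partial>P I) (\<integral>\<^sup>+x. ennreal (g x ^ card I) \<partial>P I)
    \<le> (\<integral>\<^sup>+x. ennreal (h x ^ card I) \<partial>P I)"
  using assms(2-)
proof (induction I arbitrary: f g h M rule: finite_induct)
  case empty
  show ?case by simp
next
  case (insert i I f g h M)
  let ?m = "card I"
  let ?S = "\<lambda>u x. \<integral>\<^sup>+t. ennreal (u (x(i := t)) ^ Suc ?m) \<partial>lborel"
  let ?r = "\<lambda>u x. root ?m (enn2real (?S u x))"
  let ?good = "\<lambda>u. u \<in> borel_measurable (P (insert i I)) \<and> (\<forall>x\<in>space (P (insert i I)). 0 \<le> u x \<and> u x \<le> M
       \<and> (\<forall>j\<in>insert i I. R < \<bar>x j\<bar> \<longrightarrow> u x = 0))"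
  have good: "?good f" "?good g" "?good h"
    using insert.prems by simp_all
  have upd: "x(i := t) \<in> space (P (insert i I))" if "x \<in> space (P I)" for x t
    using that by (auto simp: P_def space_PiM PiE_iff extensional_def)
  have slice: "(\<lambda>t. u (x(i := t))) \<in> borel_measurable borel" if "?good u" "x \<in> space (P I)" for u x
  proof -
    have "(\<lambda>t. x(i := t)) \<in> measurable lborel (Pi\<^sub>M (insert i I) (\<lambda>_. lborel))"
      using measurable_component_update[OF that(2)[unfolded P_def] \<open>i \<notin> I\<close>] .
    from measurable_compose[OF this, of u borel] show ?thesis
      using that by (simp add: P_def del: fun_upd_apply)
  qed
  have slice_meas: "?S u \<in> borel_measurable (P I)" if "?good u" for u
  proof -
    have [measurable]: "u \<in> borel_measurable (Pi\<^sub>M (insert i I) (\<lambda>_. lborel))"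
      using that by (simp add: P_def)
    show ?thesis unfolding P_def by measurable
  qed
  have fubini: "(\<integral>\<^sup>+x. ennreal (u x ^ Suc ?m) \<partial>P (insert i I)) = (\<integral>\<^sup>+x. ?S u x \<partial>P I)" if "?good u" for u
  proof -
    have [measurable]: "u \<in> borel_measurable (Pi\<^sub>M (insert i I) (\<lambda>_. lborel))"
      using that by (simp add: P_def)
    show ?thesis unfolding P_def using insert.hyps
      by (intro lborel_product.product_nn_integral_insert) measurable
  qed
  have bound: "?S u x \<le> ennreal (M ^ Suc ?m * (2 * R))" if u: "?good u" and x: "x \<in> space (P I)" for u x
  proof -
    have "?S u x \<le> (\<integral>\<^sup>+t. ennreal (M ^ Suc ?m) * indicator {-R..R} t \<partial>lborel)"
    proof (rule nn_integral_mono)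
      fix t
      have "u (x(i := t)) = 0" if "t \<notin> {-R..R}"
        using u upd[OF x, of t] that by (auto simp: abs_if split: if_splits)
      moreover have "u (x(i := t)) ^ Suc ?m \<le> M ^ Suc ?m"
        using u upd[OF x, of t] by (intro power_mono) auto
      ultimately show "ennreal (u (x(i := t)) ^ Suc ?m) \<le> ennreal (M ^ Suc ?m) * indicator {-R..R} t"
        by (auto split: split_indicator intro: ennreal_leI simp del: power_Suc)
    qed
    also have "\<dots> = ennreal (M ^ Suc ?m * (2 * R))"
      using \<open>0 \<le> R\<close> \<open>0 \<le> M\<close> by (simp add: nn_integral_cmult_indicator ennreal_mult del: power_Suc)
    finally show ?thesis .
  qed
  have fin: "?S u x = ennreal (enn2real (?S u x))" if "?good u" "x \<in> space (P I)" for u x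
    using bound[OF that] by (simp add: less_top[symmetric] top_unique ennreal_enn2real_if) (auto simp: top_unique)
  have slice_par: "parallel_sum (f (x(i := s))) (g (y(i := t))) \<le> h ((\<lambda>j\<in>I. x j + y j)(i := s + t))"
    if "x \<in> space (P I)" "y \<in> space (P I)" for x y s t
  proof -
    have "(\<lambda>j\<in>insert i I. (x(i := s)) j + (y(i := t)) j) = (\<lambda>j\<in>I. x j + y j)(i := s + t)"
      using \<open>i \<notin> I\<close> by (auto simp: fun_eq_iff restrict_def)
    then show ?thesis
      using insert.prems(15)[OF upd[OF that(1), of s] upd[OF that(2), of t]] by (simp only:)
  qed
  have sum_space: "(\<lambda>j\<in>I. x j + y j) \<in> space (P I)" for x y
    by (simp add: P_def space_PiM)
  have supp1: "u (x(i := t)) = 0" if "?good u" "x \<in> space (P I)" "R < \<bar>t\<bar>" for u x t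
    using that(1,3) upd[OF that(2), of t] by auto
  note hyps1 = slice[OF good(1)] slice[OF good(2)] slice[OF good(3) sum_space]
  \<comment> \<open>The last remaining coordinate is the case \<open>k = 1\<close>, where there is no root to take.\<close>
  have "min (\<integral>\<^sup>+x. ?S f x \<partial>P I) (\<integral>\<^sup>+x. ?S g x \<partial>P I) \<le> (\<integral>\<^sup>+x. ?S h x \<partial>P I)"
  proof (cases "I = {}")
    case True
    let ?x = "\<lambda>_. undefined :: real"
    have x: "?x \<in> space (P I)" using True by (simp add: P_def space_PiM)
    have "(\<lambda>j\<in>I. ?x j + ?x j) = ?x" using True by auto
    then have "min (\<integral>\<^sup>+t. ennreal (f (?x(i := t))) \<partial>lborel) (\<integral>\<^sup>+t. ennreal (g (?x(i := t))) \<partial>lborel)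
        \<le> (\<integral>\<^sup>+t. ennreal (h (?x(i := t))) \<partial>lborel)"
      using good upd[OF x] slice_par[OF x x]
      by (intro bbl_real_min[where M = M and R = R] slice[OF good(1) x] slice[OF good(2) x] slice[OF good(3) x]
            supp1[OF good(1) x] supp1[OF good(2) x]) auto
    then show ?thesis
      using True by (simp add: P_def PiM_empty nn_integral_count_space_finite fun_upd_def)
  next
    case False
    then have m: "0 < ?m" using insert.hyps by (simp add: card_gt_0_iff)
    have root_pow: "ennreal (?r u x ^ ?m) = ?S u x" if "?good u" "x \<in> space (P I)" for u x
      using fin[OF that] m by simp
    have key: "min (\<integral>\<^sup>+x. ennreal (?r f x ^ ?m) \<partial>P I) (\<integral>\<^sup>+x. ennreal (?r g x ^ ?m) \<partial>P I)
        \<le> (\<integral>\<^sup>+x. ennreal (?r h x ^ ?m) \<partial>P I)"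
    proof (rule insert.IH[where M = "root ?m (M ^ Suc ?m * (2 * R))"])
      show "0 \<le> root ?m (M ^ Suc ?m * (2 * R))" "0 \<le> R"
        using \<open>0 \<le> M\<close> \<open>0 \<le> R\<close> m by auto
      show "?r f \<in> borel_measurable (P I)" "?r g \<in> borel_measurable (P I)" "?r h \<in> borel_measurable (P I)"
        using slice_meas[OF good(1)] slice_meas[OF good(2)] slice_meas[OF good(3)]
        by (auto simp del: power_Suc)
      have up: "?r u x \<le> root ?m (M ^ Suc ?m * (2 * R))" if "?good u" "x \<in> space (P I)" for u x
        using bound[OF that] m \<open>0 \<le> M\<close> \<open>0 \<le> R\<close>
        by (intro real_root_le_mono enn2real_leI) auto
      have zero: "?r u x = 0" if u: "?good u" and x: "x \<in> space (P I)" "j \<in> I" "R < \<bar>x j\<bar>" for u x j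
      proof -
        have "u (x(i := t)) = 0" for t
          using u upd[OF x(1), of t] x \<open>i \<notin> I\<close> by (metis fun_upd_apply insertI2)
        then show ?thesis by simp
      qed
      show "\<And>x. x \<in> space (P I) \<Longrightarrow> ?r f x \<le> root ?m (M ^ Suc ?m * (2 * R))"
        "\<And>x. x \<in> space (P I) \<Longrightarrow> ?r g x \<le> root ?m (M ^ Suc ?m * (2 * R))"
        "\<And>x. x \<in> space (P I) \<Longrightarrow> ?r h x \<le> root ?m (M ^ Suc ?m * (2 * R))"
        using up good by blast+
      show "\<And>x j. x \<in> space (P I) \<Longrightarrow> j \<in> I \<Longrightarrow> R < \<bar>x j\<bar> \<Longrightarrow> ?r f x = 0"
        "\<And>x j. x \<in> space (P I) \<Longrightarrow> j \<in> I \<Longrightarrow> R < \<bar>x j\<bar> \<Longrightarrow> ?r g x = 0"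
        "\<And>x j. x \<in> space (P I) \<Longrightarrow> j \<in> I \<Longrightarrow> R < \<bar>x j\<bar> \<Longrightarrow> ?r h x = 0"
        using zero good by blast+
      show "parallel_sum (?r f x) (?r g y) \<le> ?r h (\<lambda>j\<in>I. x j + y j)" if "x \<in> space (P I)" "y \<in> space (P I)" for x y
      proof (rule bbl_real_root[where M = M and R = R and m = ?m
            and f = "\<lambda>t. f (x(i := t))" and g = "\<lambda>t. g (y(i := t))" and h = "\<lambda>t. h ((\<lambda>j\<in>I. x j + y j)(i := t))"])
        note up = upd[OF that(1)] upd[OF that(2)] upd[OF sum_space, of x y]
        show "(\<lambda>t. f (x(i := t))) \<in> borel_measurable borel" by (rule slice[OF good(1) that(1)])
        show "(\<lambda>t. g (y(i := t))) \<in> borel_measurable borel" by (rule slice[OF good(2) that(2)])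
        show "(\<lambda>t. h ((\<lambda>j\<in>I. x j + y j)(i := t))) \<in> borel_measurable borel" by (rule slice[OF good(3) sum_space])
        show "?S f x = ennreal (enn2real (?S f x))" by (rule fin[OF good(1) that(1)])
        show "?S g y = ennreal (enn2real (?S g y))" by (rule fin[OF good(2) that(2)])
        show "?S h (\<lambda>j\<in>I. x j + y j) = ennreal (enn2real (?S h (\<lambda>j\<in>I. x j + y j)))"
          by (rule fin[OF good(3) sum_space])
        show "f (x(i := t)) = 0" if "R < \<bar>t\<bar>" for t by (rule supp1[OF good(1) \<open>x \<in> space (P I)\<close> that])
        show "g (y(i := t)) = 0" if "R < \<bar>t\<bar>" for t by (rule supp1[OF good(2) \<open>y \<in> space (P I)\<close> that])
        show "parallel_sum (f (x(i := s))) (g (y(i := t))) \<le> h ((\<lambda>j\<in>I. x j + y j)(i := s + t))" for s t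
          by (rule slice_par[OF that])
        show "0 \<le> f (x(i := t))" "f (x(i := t)) \<le> M" "0 \<le> g (y(i := t))" "g (y(i := t)) \<le> M"
          "0 \<le> h ((\<lambda>j\<in>I. x j + y j)(i := t))" for t
          using good up by blast+
      qed (use m in auto)
    qed (use m in \<open>auto simp del: power_Suc\<close>)
    have "(\<integral>\<^sup>+x. ennreal (?r u x ^ ?m) \<partial>P I) = (\<integral>\<^sup>+x. ?S u x \<partial>P I)" if "?good u" for u
      using root_pow[OF that] by (intro nn_integral_cong) auto
    from this[OF good(1)] this[OF good(2)] this[OF good(3)] key show ?thesis by (simp del: power_Suc)
  qed
  then show ?case
    using fubini[OF good(1)] fubini[OF good(2)] fubini[OF good(3)] insert.hyps by (simp del: power_Suc)
qed

lemma bbl_bounded: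
  fixes f g h :: "'a::euclidean_space \<Rightarrow> real"
  assumes [measurable]: "f \<in> borel_measurable borel" "g \<in> borel_measurable borel" "h \<in> borel_measurable borel"
    and nonneg: "\<And>x. 0 \<le> f x" "\<And>x. 0 \<le> g x" "\<And>x. 0 \<le> h x"
    and bound: "\<And>x. f x \<le> M" "\<And>x. g x \<le> M" "\<And>x. h x \<le> M"
    and supp: "\<And>x b. b \<in> Basis \<Longrightarrow> R < \<bar>x \<bullet> b\<bar> \<Longrightarrow> f x = 0" "\<And>x b. b \<in> Basis \<Longrightarrow> R < \<bar>x \<bullet> b\<bar> \<Longrightarrow> g x = 0"
      "\<And>x b. b \<in> Basis \<Longrightarrow> R < \<bar>x \<bullet> b\<bar> \<Longrightarrow> h x = 0"
    and R: "0 \<le> R"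
    and par: "\<And>x y. parallel_sum (f x) (g y) \<le> h (x + y)"
  shows "min (\<integral>\<^sup>+x. ennreal (f x ^ DIM('a)) \<partial>lborel) (\<integral>\<^sup>+x. ennreal (g x ^ DIM('a)) \<partial>lborel)
    \<le> (\<integral>\<^sup>+x. ennreal (h x ^ DIM('a)) \<partial>lborel)"
proof -
  let ?P = "Pi\<^sub>M (Basis :: 'a set) (\<lambda>_. lborel :: real measure)"
  define T where "T \<phi> = (\<Sum>b\<in>Basis. \<phi> b *\<^sub>R b)" for \<phi> :: "'a \<Rightarrow> real"
  have T[measurable]: "T \<in> measurable ?P borel"
    unfolding T_def by measurable
  have inner: "T \<phi> \<bullet> b = \<phi> b" if "b \<in> Basis" for \<phi> b
    using that by (simp add: T_def inner_sum_left inner_Basis if_distrib sum.If_cases cong: if_cong)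
  have add: "T (\<lambda>b\<in>Basis. \<phi> b + \<psi> b) = T \<phi> + T \<psi>" for \<phi> \<psi>
    by (simp add: T_def scaleR_left_distrib sum.distrib)
  have pull: "(\<integral>\<^sup>+x. ennreal (u x ^ DIM('a)) \<partial>lborel) = (\<integral>\<^sup>+\<phi>. ennreal (u (T \<phi>) ^ DIM('a)) \<partial>?P)"
    if [measurable]: "u \<in> borel_measurable borel" for u :: "'a \<Rightarrow> real"
    by (subst lborel_eq) (simp add: nn_integral_distr T[unfolded T_def] flip: T_def)
  have "0 \<le> M" using nonneg(1)[of 0] bound(1)[of 0] by linarith
  then show ?thesis
    unfolding pull[OF assms(1)] pull[OF assms(2)] pull[OF assms(3)]
    using R nonneg bound par
    by (intro bbl_PiM[where M = M and R = R])
       (auto simp: add inner intro: supp)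
qed

text \<open>
  Cut \<open>f\<close> and \<open>g\<close> off at height \<open>j\<close> and to the cube of half-width \<open>j\<close>. Then \<open>h\<close> may be cut off at height \<open>j\<close>, since
  a parallel sum is at most each of its arguments, and to the cube of half-width \<open>2 j\<close>, since the parallel sum
  vanishes unless both \<open>x\<close> and \<open>y\<close> lie in the smaller cube. Monotone convergence removes the cut-off.
\<close>

theorem borell_brascamp_lieb:
  fixes f g h :: "'a::euclidean_space \<Rightarrow> real"
  assumes [measurable]: "f \<in> borel_measurable borel" "g \<in> borel_measurable borel" "h \<in> borel_measurable borel"
    and nonneg: "\<And>x. 0 \<le> f x" "\<And>x. 0 \<le> g x" "\<And>x. 0 \<le> h x"
    and par: "\<And>x y. parallel_sum (f x) (g y) \<le> h (x + y)"
  shows "min (\<integral>\<^sup>+x. ennreal (f x ^ DIM('a)) \<partial>lborel) (\<integral>\<^sup>+x. ennreal (g x ^ DIM('a)) \<partial>lborel)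
    \<le> (\<integral>\<^sup>+x. ennreal (h x ^ DIM('a)) \<partial>lborel)"
proof -
  define C where "C r = {x::'a. \<forall>b\<in>Basis. \<bar>x \<bullet> b\<bar> \<le> r}" for r :: real
  have [measurable]: "C r \<in> sets borel" for r
    unfolding C_def by measurable
  define cut where "cut j u x = min (u x) (real j) * indicator (C j) x" for j and u :: "'a \<Rightarrow> real" and x
  have [measurable]: "cut j u \<in> borel_measurable borel" if "u \<in> borel_measurable borel" for j u
    using that unfolding cut_def by measurable
  have cut_nonneg: "0 \<le> cut j u x" if "\<And>x. 0 \<le> u x" for j u x
    using that[of x] by (simp add: cut_def)
  have cut_le: "cut j u x \<le> u x" if "\<And>x. 0 \<le> u x" for j u x
    using that[of x] by (simp add: cut_def split: split_indicator)
  have lim: "(\<lambda>j. \<integral>\<^sup>+x. ennreal (cut j u x ^ DIM('a)) \<partial>lborel) \<longlonglongrightarrow> (\<integral>\<^sup>+x. ennreal (u x ^ DIM('a)) \<partial>lborel)"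
    if [measurable]: "u \<in> borel_measurable borel" and u: "\<And>x. 0 \<le> u x" for u
  proof (rule nn_integral_LIMSEQ)
    show "incseq (\<lambda>j x. ennreal (cut j u x ^ DIM('a)))"
    proof (rule incseq_SucI, rule le_funI, rule ennreal_leI, rule power_mono)
      fix j x
      have "C (real j) \<subseteq> C (real (Suc j))"
        unfolding C_def by (auto intro: order_trans)
      then show "cut j u x \<le> cut (Suc j) u x"
        using u[of x] unfolding cut_def by (auto split: split_indicator simp: min_def)
      show "0 \<le> cut j u x" using u by (rule cut_nonneg)
    qed
    fix x
    obtain N :: nat where N: "max (u x) (norm x) \<le> N"
      using real_arch_simple by blast
    have "cut j u x = u x" if "N \<le> j" for j
    proof -
      have "norm x \<le> j" "u x \<le> j" using N that by auto
      then show ?thesis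
        using Basis_le_norm[of _ x] by (auto simp: cut_def C_def min_def intro: order_trans split: split_indicator)
    qed
    then show "(\<lambda>j. ennreal (cut j u x ^ DIM('a))) \<longlonglongrightarrow> ennreal (u x ^ DIM('a))"
      by (intro tendsto_eventually eventually_sequentiallyI[of N]) simp
  qed measurable
  have le: "min (\<integral>\<^sup>+x. ennreal (cut j f x ^ DIM('a)) \<partial>lborel) (\<integral>\<^sup>+x. ennreal (cut j g x ^ DIM('a)) \<partial>lborel)
      \<le> (\<integral>\<^sup>+x. ennreal (h x ^ DIM('a)) \<partial>lborel)" for j
  proof -
    have "min (\<integral>\<^sup>+x. ennreal (cut j f x ^ DIM('a)) \<partial>lborel) (\<integral>\<^sup>+x. ennreal (cut j g x ^ DIM('a)) \<partial>lborel)
      \<le> (\<integral>\<^sup>+x. ennreal ((min (h x) j * indicator (C (2 * j)) x) ^ DIM('a)) \<partial>lborel)"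
    proof (rule bbl_bounded[where M = j and R = "2 * real j"])
      fix x y
      show "parallel_sum (cut j f x) (cut j g y) \<le> min (h (x + y)) (real j) * indicator (C (2 * j)) (x + y)"
      proof (cases "x \<in> C j \<and> y \<in> C j")
        case True
        then have "x + y \<in> C (2 * j)"
          unfolding C_def by (fastforce simp: inner_add_left intro: order_trans[OF abs_triangle_ineq])
        moreover have "parallel_sum (cut j f x) (cut j g y) \<le> h (x + y)"
          using parallel_sum_mono[of "cut j f x" "f x" "cut j g y" "g y"] cut_nonneg cut_le nonneg par[of x y] by force
        moreover have "parallel_sum (cut j f x) (cut j g y) \<le> j"
          using parallel_sum_le(1)[of "cut j f x" "cut j g y"] cut_nonneg nonneg True
          by (force simp: cut_def min_def)
        ultimately show ?thesis by simp
      next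
        case False
        then show ?thesis using nonneg by (auto simp: cut_def)
      qed
    qed (use nonneg in \<open>auto simp: cut_def C_def split: split_indicator\<close>)
    also have "\<dots> \<le> (\<integral>\<^sup>+x. ennreal (h x ^ DIM('a)) \<partial>lborel)"
      using nonneg by (intro nn_integral_mono ennreal_leI power_mono) (auto split: split_indicator)
    finally show ?thesis .
  qed
  show ?thesis
    using nonneg le by (intro LIMSEQ_le_const2[OF tendsto_min[OF lim lim]]) auto
qed

section \<open>The Hopf-Lax semigroup and the Legendre transform\<close>

lemma nn_integral_lborel_scaleR:
  fixes u :: "'a::euclidean_space \<Rightarrow> ennreal"
  assumes [measurable]: "u \<in> borel_measurable borel" and "0 < c"
  shows "ennreal (c ^ DIM('a)) * (\<integral>\<^sup>+x. u (c *\<^sub>R x) \<partial>lborel) = (\<integral>\<^sup>+x. u x \<partial>lborel)"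
proof -
  have "(\<integral>\<^sup>+x. u x \<partial>lborel) = (\<integral>\<^sup>+x. u x \<partial>density (distr lborel borel (\<lambda>x::'a. 0 + c *\<^sub>R x)) (\<lambda>_. \<bar>c\<bar> ^ DIM('a)))"
    using lborel_affine[of c "0::'a"] \<open>0 < c\<close> by simp
  also have "\<dots> = ennreal (c ^ DIM('a)) * (\<integral>\<^sup>+x. u (c *\<^sub>R x) \<partial>lborel)"
    using \<open>0 < c\<close> by (simp add: nn_integral_density nn_integral_distr nn_integral_cmult)
  finally show ?thesis by simp
qed

definition hopf_lax :: "('a::euclidean_space \<Rightarrow> real) \<Rightarrow> ('a \<Rightarrow> real) \<Rightarrow> real \<Rightarrow> 'a \<Rightarrow> real" where
  "hopf_lax W g t x = (INF y. g (x - t *\<^sub>R y) + t * W y)"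

lemma
  fixes g W :: "'a::euclidean_space \<Rightarrow> real"
  assumes g: "\<And>x. 0 < g x" and W: "\<And>x. 0 < W x" and t: "0 < t"
  shows hopf_lax_le: "hopf_lax W g t x \<le> g (x - t *\<^sub>R y) + t * W y"
    and hopf_lax_less_iff: "hopf_lax W g t x < a \<longleftrightarrow> (\<exists>y. g (x - t *\<^sub>R y) + t * W y < a)"
proof -
  have "0 \<le> g (x - t *\<^sub>R y) + t * W y" for y
    using g[of "x - t *\<^sub>R y"] W[of y] t by simp
  then have bdd: "bdd_below (range (\<lambda>y. g (x - t *\<^sub>R y) + t * W y))"
    by (auto intro!: bdd_belowI[of _ 0])
  show "hopf_lax W g t x \<le> g (x - t *\<^sub>R y) + t * W y"
    unfolding hopf_lax_def by (rule cINF_lower[OF bdd]) simp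
  show "hopf_lax W g t x < a \<longleftrightarrow> (\<exists>y. g (x - t *\<^sub>R y) + t * W y < a)"
    unfolding hopf_lax_def by (simp add: cINF_less_iff[OF _ bdd])
qed

text \<open>
  An infimum of continuous functions is upper semicontinuous.
\<close>

lemma hopf_lax_measurable:
  fixes g W :: "'a::euclidean_space \<Rightarrow> real"
  assumes "\<And>x. 0 < g x" "\<And>x. 0 < W x" "0 < t" and cont: "continuous_on UNIV g"
  shows "hopf_lax W g t \<in> borel_measurable borel"
proof (rule borel_measurableI_less)
  fix a
  have "{x \<in> space borel. hopf_lax W g t x < a} = (\<Union>y. {x. g (x - t *\<^sub>R y) + t * W y < a})"
    using assms by (auto simp: hopf_lax_less_iff)
  also have "open \<dots>"
    by (intro open_UN ballI open_Collect_less continuous_intros continuous_on_compose2[OF cont]) auto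
  finally show "{x \<in> space borel. hopf_lax W g t x < a} \<in> sets borel" by simp
qed

text \<open>
  The Borell-Brascamp-Lieb inequality for \<open>1 / g\<close> and \<open>z \<mapsto> 1 / (t W (z / t))\<close>. The factor \<open>t\<close> in front of \<open>W\<close>
  and the dilation of its argument cancel in the integral of the \<open>n\<close>-th power.
\<close>

lemma hopf_lax_integral_ge:
  fixes g W :: "'a::euclidean_space \<Rightarrow> real"
  assumes pos: "\<And>x. 0 < g x" "\<And>x. 0 < W x" "0 < t"
    and cont: "continuous_on UNIV g" "continuous_on UNIV W"
    and Q: "\<And>x. 0 < hopf_lax W g t x"
  shows "min (\<integral>\<^sup>+x. ennreal (1 / g x ^ DIM('a)) \<partial>lborel) (\<integral>\<^sup>+x. ennreal (1 / W x ^ DIM('a)) \<partial>lborel)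
    \<le> (\<integral>\<^sup>+x. ennreal (1 / hopf_lax W g t x ^ DIM('a)) \<partial>lborel)"
proof -
  have [measurable]: "g \<in> borel_measurable borel" "W \<in> borel_measurable borel"
    "hopf_lax W g t \<in> borel_measurable borel"
    using cont hopf_lax_measurable[OF pos cont(1)] by (auto intro: borel_measurable_continuous_onI)
  have "min (\<integral>\<^sup>+x. ennreal ((1 / g x) ^ DIM('a)) \<partial>lborel)
      (\<integral>\<^sup>+x. ennreal ((1 / (t * W ((1 / t) *\<^sub>R x))) ^ DIM('a)) \<partial>lborel)
    \<le> (\<integral>\<^sup>+x. ennreal ((1 / hopf_lax W g t x) ^ DIM('a)) \<partial>lborel)"
  proof (rule borell_brascamp_lieb)
    fix x z
    let ?b = "t * W ((1 / t) *\<^sub>R z)"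
    have p: "0 < g x" "0 < ?b" using pos by auto
    have "hopf_lax W g t (x + z) \<le> g (x + z - t *\<^sub>R (1 / t) *\<^sub>R z) + ?b"
      using pos by (rule hopf_lax_le)
    then have "hopf_lax W g t (x + z) \<le> g x + ?b"
      using pos by simp
    then have "1 / (g x + ?b) \<le> 1 / hopf_lax W g t (x + z)"
      using Q[of "x + z"] p by (intro divide_left_mono) auto
    moreover have "parallel_sum (1 / g x) (1 / ?b) = 1 / (g x + ?b)"
    proof -
      have "parallel_sum (1 / a) (1 / b) = 1 / (a + b)" if "0 < a" "0 < b" for a b
        using that by (simp add: parallel_sum_def field_simps)
      then show ?thesis using p by blast
    qed
    ultimately show "parallel_sum (1 / g x) (1 / ?b) \<le> 1 / hopf_lax W g t (x + z)" by simp
  qed (use pos Q in \<open>auto simp: less_imp_le intro: mult_nonneg_nonneg\<close>)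
  moreover have "(\<integral>\<^sup>+x. ennreal ((1 / (t * W ((1 / t) *\<^sub>R x))) ^ DIM('a)) \<partial>lborel)
      = (\<integral>\<^sup>+x. ennreal (1 / W x ^ DIM('a)) \<partial>lborel)"
  proof -
    have "ennreal ((1 / (t * W ((1 / t) *\<^sub>R x))) ^ DIM('a))
        = ennreal ((1 / t) ^ DIM('a)) * ennreal (1 / W ((1 / t) *\<^sub>R x) ^ DIM('a))" for x
      using pos(2)[of "(1 / t) *\<^sub>R x"] pos(3) by (simp add: power_divide power_mult_distrib flip: ennreal_mult)
    then show ?thesis
      using nn_integral_lborel_scaleR[of "\<lambda>x. ennreal (1 / W x ^ DIM('a))" "1 / t"] pos(3)
      by (simp add: nn_integral_cmult)
  qed
  ultimately show ?thesis by (simp add: power_divide)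
qed

lemma C1_continuous_on: "C1 f \<Longrightarrow> continuous_on UNIV f"
  unfolding C1_def by (auto simp: continuous_on_eq_continuous_at intro: differentiable_imp_continuous_within)

lemma C1_has_derivative: "C1 f \<Longrightarrow> (f has_derivative (\<lambda>h. h \<bullet> grad f x)) (at x)"
  unfolding C1_def using differentiable_GDERIV_grad[of f x] by (simp add: gderiv_def)

lemma C1_gradient_bound:
  fixes f :: "'a::euclidean_space \<Rightarrow> real"
  assumes f: "C1 f" and B: "\<And>z. norm (z - x) \<le> norm h \<Longrightarrow> norm (grad f z) \<le> B"
  shows "\<bar>f (x + h) - f x\<bar> \<le> B * norm h"
proof -
  have "norm (f (x + h) - f x) \<le> B * norm (x + h - x)"
  proof (rule differentiable_bound[where S = "cball x (norm h)"])
    show "(f has_derivative (\<lambda>k. k \<bullet> grad f z)) (at z within cball x (norm h))" for z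
      using C1_has_derivative[OF f] by (rule has_derivative_at_withinI)
    fix z assume "z \<in> cball x (norm h)"
    then have "norm (grad f z) \<le> B"
      by (intro B) (simp add: dist_norm norm_minus_commute)
    show "onorm (\<lambda>k. k \<bullet> grad f z) \<le> B"
    proof (rule onorm_le)
      fix k :: 'a
      have "norm (k \<bullet> grad f z) \<le> norm k * norm (grad f z)"
        by (simp add: Cauchy_Schwarz_ineq2)
      also have "\<dots> \<le> B * norm k"
        using mult_left_mono[OF \<open>norm (grad f z) \<le> B\<close>, of "norm k"] by (simp add: mult.commute)
      finally show "norm (k \<bullet> grad f z) \<le> B * norm k" .
    qed
  qed (auto simp: dist_norm)
  then show ?thesis by simp
qed

text \<open>
  The quadratic lower bound on \<open>W\<close> makes \<open>W\<^sup>*\<close> real-valued, with the dual quadratic function as an upper bound.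
\<close>

lemma
  fixes W :: "'a::euclidean_space \<Rightarrow> real"
  assumes C: "0 < C" and W: "\<And>x. W x \<ge> 1 / C * ((norm x)\<^sup>2 / 2)"
  shows legendre_finite: "\<bar>legendre W p\<bar> \<noteq> \<infinity>"
    and legendre_ge: "p \<bullet> y - W y \<le> real_of_ereal (legendre W p)"
    and legendre_le: "real_of_ereal (legendre W p) \<le> C * (norm p)\<^sup>2 / 2"
    and legendre_less_iff: "a < real_of_ereal (legendre W p) \<longleftrightarrow> (\<exists>y. a < p \<bullet> y - W y)"
proof -
  have "p \<bullet> y - W y \<le> C * (norm p)\<^sup>2 / 2" for y
  proof -
    have "0 \<le> (C * norm p - norm y)\<^sup>2" by simp
    then have "2 * C * (norm p * norm y) \<le> C\<^sup>2 * (norm p)\<^sup>2 + (norm y)\<^sup>2"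
      by (simp add: power2_eq_square algebra_simps)
    then have "norm p * norm y - 1 / C * ((norm y)\<^sup>2 / 2) \<le> C * (norm p)\<^sup>2 / 2"
      using C by (simp add: field_simps power2_eq_square)
    then show ?thesis
      using norm_cauchy_schwarz[of p y] W[of y] by linarith
  qed
  then have up: "legendre W p \<le> ereal (C * (norm p)\<^sup>2 / 2)"
    unfolding legendre_def by (auto intro!: SUP_least)
  have lo: "ereal (p \<bullet> y - W y) \<le> legendre W p" for y
    unfolding legendre_def by (rule SUP_upper) simp
  show fin: "\<bar>legendre W p\<bar> \<noteq> \<infinity>"
    using up lo[of 0] by auto
  then obtain l where l: "legendre W p = ereal l" by auto
  show "p \<bullet> y - W y \<le> real_of_ereal (legendre W p)"
    using lo[of y] l by simp
  show "real_of_ereal (legendre W p) \<le> C * (norm p)\<^sup>2 / 2"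
    using up l by simp
  have "a < real_of_ereal (legendre W p) \<longleftrightarrow> ereal a < legendre W p"
    by (simp add: l)
  also have "\<dots> \<longleftrightarrow> (\<exists>y. a < p \<bullet> y - W y)"
    unfolding legendre_def less_SUP_iff by simp
  finally show "a < real_of_ereal (legendre W p) \<longleftrightarrow> (\<exists>y. a < p \<bullet> y - W y)" .
qed

lemma legendre_measurable:
  fixes W :: "'a::euclidean_space \<Rightarrow> real"
  assumes "0 < C" "\<And>x. W x \<ge> 1 / C * ((norm x)\<^sup>2 / 2)"
  shows "(\<lambda>p. real_of_ereal (legendre W p)) \<in> borel_measurable borel"
proof (rule borel_measurableI_greater)
  fix a
  have "{p \<in> space borel. a < real_of_ereal (legendre W p)} = (\<Union>y. {p. a < p \<bullet> y - W y})"
    by (auto simp: legendre_less_iff[OF assms])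
  also have "open \<dots>"
    by (intro open_UN ballI open_Collect_less continuous_intros)
  finally show "{p \<in> space borel. a < real_of_ereal (legendre W p)} \<in> sets borel" by simp
qed

lemma power_minus_one_le:
  fixes a :: real
  assumes "0 \<le> a" "a \<le> 2"
  shows "\<bar>a ^ n - 1\<bar> \<le> real n * 2 ^ n * \<bar>a - 1\<bar>"
proof (induction n)
  case (Suc n)
  have "a ^ Suc n - 1 = a * (a ^ n - 1) + (a - 1)" by (simp add: algebra_simps)
  then have "\<bar>a ^ Suc n - 1\<bar> \<le> a * \<bar>a ^ n - 1\<bar> + \<bar>a - 1\<bar>"
    using assms abs_triangle_ineq[of "a * (a ^ n - 1)" "a - 1"] by (simp add: abs_mult)
  also have "\<dots> \<le> 2 * (real n * 2 ^ n * \<bar>a - 1\<bar>) + 2 ^ Suc n * \<bar>a - 1\<bar>"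
    using assms Suc.IH mult_right_mono[of 1 "2 ^ Suc n" "\<bar>a - 1\<bar>"]
    by (intro add_mono mult_mono) (auto simp del: power_Suc)
  finally show ?case by (simp add: algebra_simps)
qed simp

lemma difference_quotient_tendsto:
  fixes F :: "real \<Rightarrow> real"
  assumes F: "(F has_field_derivative F') (at a)" and t: "t \<longlonglongrightarrow> 0" "\<And>k. t k \<noteq> 0" and d: "d \<longlonglongrightarrow> D"
  shows "(\<lambda>k. (F (a + t k * d k) - F a) / t k) \<longlonglongrightarrow> F' * D"
proof -
  \<comment> \<open>Caratheodory: the difference quotient is a function \<open>G\<close> continuous at \<open>a\<close>.\<close>
  obtain G where G: "\<And>z. F z - F a = G z * (z - a)" "isCont G a" "G a = F'"
    using F unfolding CARAT_DERIV by auto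
  have "(\<lambda>k. a + t k * d k) \<longlonglongrightarrow> a + 0 * D"
    by (intro tendsto_intros t d)
  then have "(\<lambda>k. G (a + t k * d k) * d k) \<longlonglongrightarrow> F' * D"
    using G(2,3) d by (auto intro!: tendsto_mult isCont_tendsto_compose[of a G])
  then show ?thesis using t(2) by (simp add: G(1))
qed

section \<open>The derivative of the Hopf-Lax semigroup at time zero\<close>

text \<open>
  The constants below depend on \<open>C\<close> and \<open>W 0\<close> only; all bounds are relative to \<open>g x\<close>, which dominates
  \<open>(norm x + 1)\<^sup>2\<close> up to a factor. This is what makes \<open>1 / g x\<^sup>n\<close> a dominating function.
\<close>

locale comparison =
  fixes g W :: "'a::euclidean_space \<Rightarrow> real" and C :: real
  assumes C1_g: "C1 g" and C1_W: "C1 W"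
    and g_pos: "\<And>x. 0 < g x" and W_pos: "\<And>x. 0 < W x" and C_pos: "0 < C"
    and W_ge: "\<And>x. W x \<ge> 1 / C * ((norm x)\<^sup>2 / 2)"
    and g_ge: "\<And>x. 1 / C * ((norm x)\<^sup>2 + 1) \<le> g x"
    and grad_g: "\<And>x. norm (grad g x) \<le> C * (norm x + 1)"
begin

definition L :: "'a \<Rightarrow> real" where
  "L x = real_of_ereal (legendre W (grad g x))"

text \<open>
  A factor for which both \<open>- K g\<close> bounds the difference quotients of the Hopf-Lax semigroup from below and \<open>K g\<close>
  bounds \<open>L\<close> from above.
\<close>

definition K :: real where
  "K = 2 * C ^ 4"

lemma norm_sq_le_g: "(norm x + 1)\<^sup>2 \<le> 2 * C * g x"
proof -
  have "0 \<le> (norm x - 1)\<^sup>2" by simp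
  then have "(norm x + 1)\<^sup>2 \<le> 2 * ((norm x)\<^sup>2 + 1)"
    by (simp add: power2_eq_square algebra_simps)
  also have "(norm x)\<^sup>2 + 1 \<le> C * g x"
    using g_ge[of x] C_pos by (simp add: field_simps)
  finally show ?thesis by simp
qed

lemma L_le: "L x \<le> K * g x"
proof -
  have "L x \<le> C * (norm (grad g x))\<^sup>2 / 2"
    unfolding L_def using C_pos W_ge by (rule legendre_le)
  also have "\<dots> \<le> C * (C * (norm x + 1))\<^sup>2 / 2"
    using C_pos grad_g[of x] by (intro divide_right_mono mult_left_mono power_mono) auto
  also have "\<dots> \<le> C ^ 3 * (norm x + 1)\<^sup>2"
  proof -
    have "C * (C * (norm x + 1))\<^sup>2 / 2 = C ^ 3 * (norm x + 1)\<^sup>2 / 2"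
      by (simp add: power_mult_distrib power2_eq_square power3_eq_cube)
    then show ?thesis using C_pos by simp
  qed
  also have "\<dots> \<le> C ^ 3 * (2 * C * g x)"
    using C_pos norm_sq_le_g by (intro mult_left_mono) auto
  also have "\<dots> = K * g x"
    by (simp add: K_def power4_eq_xxxx power3_eq_cube)
  finally show ?thesis .
qed

lemma L_ge: "grad g x \<bullet> y - W y \<le> L x"
  unfolding L_def using C_pos W_ge by (rule legendre_ge)

text \<open>
  By the mean value theorem the increment of \<open>g\<close>, divided by \<open>t\<close>, costs at most \<open>C (norm x + t norm y + 1) norm y\<close>. For small \<open>t\<close> half of
  the quadratic growth of \<open>W\<close> absorbs the part of this that is quadratic in \<open>y\<close>; the other half remains.
\<close>

lemma increment_ge:
  assumes t: "0 < t" "t \<le> 1 / (4 * C\<^sup>2)"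
  shows "(g (x - t *\<^sub>R y) - g x) / t + W y \<ge> (norm y)\<^sup>2 / (4 * C) - C * (norm x + 1) * norm y"
proof -
  let ?r = "norm y"
  have "\<bar>g (x + - (t *\<^sub>R y)) - g x\<bar> \<le> (C * (norm x + t * ?r + 1)) * norm (- (t *\<^sub>R y))"
  proof (rule C1_gradient_bound[OF C1_g])
    fix z assume z: "norm (z - x) \<le> norm (- (t *\<^sub>R y))"
    then have "norm z \<le> norm x + t * ?r"
      using norm_triangle_sub[of z x] t by simp
    then have "C * (norm z + 1) \<le> C * (norm x + t * ?r + 1)"
      using C_pos by simp
    with grad_g[of z] show "norm (grad g z) \<le> C * (norm x + t * ?r + 1)" by linarith
  qed
  then have "g (x - t *\<^sub>R y) - g x \<ge> - (t * (C * (norm x + t * ?r + 1) * ?r))"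
    using t by (simp add: mult_ac)
  then have "- (C * (norm x + t * ?r + 1) * ?r) \<le> (g (x - t *\<^sub>R y) - g x) / t"
    using t by (simp add: pos_le_divide_eq mult_ac)
  moreover have "C * (norm x + t * ?r + 1) * ?r = C * (norm x + 1) * ?r + t * C * ?r\<^sup>2"
    by (simp add: algebra_simps power2_eq_square)
  moreover have "t * C * ?r\<^sup>2 \<le> ?r\<^sup>2 / (4 * C)"
    using mult_right_mono[of "t * C" "1 / (4 * C)" "?r\<^sup>2"] t C_pos by (auto simp: field_simps power2_eq_square)
  moreover have "1 / C * (?r\<^sup>2 / 2) = ?r\<^sup>2 / (4 * C) + ?r\<^sup>2 / (4 * C)"
    using C_pos by (simp add: field_simps)
  moreover note W_ge[of y]
  moreover have "F - P \<le> q + w"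
    if "- A \<le> q" "A = P + B" "B \<le> F" "V = F + F" "V \<le> w" for A B F P V q w :: real
    using that by linarith
  ultimately show ?thesis by blast
qed

text \<open>
  The difference quotient of the Hopf-Lax semigroup, capped by its limit. Capping decreases \<open>g + t D\<close> and so
  preserves the lower bound on the integral of its power \<open>- n\<close>, while it makes the upper half of the convergence to
  \<open>- L\<close> trivial.
\<close>

definition D :: "real \<Rightarrow> 'a \<Rightarrow> real" where
  "D t x = min ((hopf_lax W g t x - g x) / t) (- L x)"

lemma hopf_lax_ge:
  assumes t: "0 < t" and le: "\<And>y. a \<le> (g (x - t *\<^sub>R y) - g x) / t + W y"
  shows "a \<le> (hopf_lax W g t x - g x) / t"
proof -
  have "g x + t * a \<le> g (x - t *\<^sub>R y) + t * W y" for y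
    using le[of y] t by (simp add: field_simps)
  then have "\<not> hopf_lax W g t x < g x + t * a"
    using g_pos W_pos t by (auto simp: hopf_lax_less_iff not_less)
  then show ?thesis using t by (simp add: field_simps)
qed

text \<open>
  Minimise \<open>increment_ge\<close> over \<open>norm y\<close>.
\<close>

lemma D_ge:
  assumes t: "0 < t" "t \<le> 1 / (4 * C\<^sup>2)"
  shows "- (K * g x) \<le> D t x"
proof -
  have "- (K * g x) \<le> (g (x - t *\<^sub>R y) - g x) / t + W y" for y
  proof -
    let ?a = "C * (norm x + 1)" and ?r = "norm y"
    have "0 \<le> (?r - 2 * C * ?a)\<^sup>2" by simp
    then have "?a * ?r * (4 * C) \<le> ?r\<^sup>2 + 4 * C\<^sup>2 * ?a\<^sup>2"
      by (simp add: power2_eq_square algebra_simps)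
    then have "?a * ?r \<le> (?r\<^sup>2 + 4 * C\<^sup>2 * ?a\<^sup>2) / (4 * C)"
      using C_pos by (simp add: pos_le_divide_eq)
    also have "\<dots> = ?r\<^sup>2 / (4 * C) + C ^ 3 * (norm x + 1)\<^sup>2"
      using C_pos by (simp add: add_divide_distrib power_mult_distrib power2_eq_square power3_eq_cube)
    finally have "- (C ^ 3 * (norm x + 1)\<^sup>2) \<le> ?r\<^sup>2 / (4 * C) - ?a * ?r" by simp
    moreover have "C ^ 3 * (norm x + 1)\<^sup>2 \<le> C ^ 3 * (2 * C * g x)"
      using C_pos norm_sq_le_g by (intro mult_left_mono) auto
    moreover have "\<dots> = K * g x"
      by (simp add: K_def power4_eq_xxxx power3_eq_cube)
    ultimately show ?thesis using increment_ge[OF t, of y x] by linarith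
  qed
  then show ?thesis
    using hopf_lax_ge[OF t(1)] L_le[of x] by (auto simp: D_def)
qed

lemma D_le: "D t x \<le> W 0"
  using L_ge[of x 0] by (simp add: D_def)

text \<open>
  For \<open>y\<close> in a ball of radius \<open>R\<close> differentiability of \<open>g\<close> at \<open>x\<close> applies uniformly. Outside it, coercivity makes
  the expression under the infimum at least \<open>W 0\<close>, which is at least \<open>- L x\<close>.
\<close>

lemma D_lower_limit:
  assumes \<epsilon>: "0 < \<epsilon>"
  obtains \<delta> where "0 < \<delta>" "\<And>t. 0 < t \<Longrightarrow> t < \<delta> \<Longrightarrow> - L x - \<epsilon> \<le> D t x"
proof -
  define a where "a = C * (norm x + 1)"
  \<comment> \<open>Chosen so that \<open>norm y \<ge> R\<close> implies \<open>norm y / (4 C) - a \<ge> W 0\<close> and \<open>norm y \<ge> 1\<close>.\<close>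
  define R where "R = 4 * C * (a + W 0) + 1"
  have R: "1 \<le> R"
    using C_pos W_pos[of 0] by (simp add: R_def a_def)
  have "(g has_derivative (\<lambda>h. h \<bullet> grad g x)) (at x)"
    using C1_g by (rule C1_has_derivative)
  moreover have "0 < \<epsilon> / R" using \<epsilon> R by simp
  ultimately obtain d where d: "0 < d"
    "\<And>z. norm (z - x) < d \<Longrightarrow> norm (g z - g x - (z - x) \<bullet> grad g x) \<le> \<epsilon> / R * norm (z - x)"
    unfolding has_derivative_at_alt by blast
  show thesis
  proof (rule that)
    show "0 < min (d / R) (1 / (4 * C\<^sup>2))"
      using d R C_pos by simp
    fix t assume t: "0 < t" "t < min (d / R) (1 / (4 * C\<^sup>2))"
    have "- L x - \<epsilon> \<le> (g (x - t *\<^sub>R y) - g x) / t + W y" for y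
    proof (cases "norm y < R")
      case True
      have "norm (- (t *\<^sub>R y)) < d"
      proof -
        have "t * norm y \<le> t * R" using True t by simp
        also have "\<dots> < d" using t R by (simp add: field_simps)
        finally show ?thesis using t by simp
      qed
      with d(2)[of "x - t *\<^sub>R y"] t
      have "\<bar>g (x - t *\<^sub>R y) - g x + t * (y \<bullet> grad g x)\<bar> \<le> \<epsilon> / R * (t * norm y)"
        by simp
      also have "\<dots> \<le> \<epsilon> / R * (t * R)"
        using True t \<epsilon> R by (intro mult_left_mono) auto
      also have "\<dots> = t * \<epsilon>" using R by simp
      finally have "- (t * (y \<bullet> grad g x + \<epsilon>)) \<le> g (x - t *\<^sub>R y) - g x"
        by (simp add: abs_le_iff algebra_simps)
      then have "- (y \<bullet> grad g x + \<epsilon>) \<le> (g (x - t *\<^sub>R y) - g x) / t"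
        using t by (subst pos_le_divide_eq) (simp_all add: algebra_simps)
      then show ?thesis using L_ge[of x y] by (simp add: inner_commute)
    next
      case False
      have "a + W 0 \<le> norm y / (4 * C)"
        using False C_pos by (simp add: R_def pos_le_divide_eq mult.commute)
      then have "W 0 * norm y \<le> (norm y / (4 * C) - a) * norm y"
        by (intro mult_right_mono) auto
      moreover have "W 0 * 1 \<le> W 0 * norm y"
        using False R W_pos[of 0] by (intro mult_left_mono) auto
      moreover have "(norm y / (4 * C) - a) * norm y = (norm y)\<^sup>2 / (4 * C) - a * norm y"
        by (simp add: algebra_simps power2_eq_square)
      ultimately have "W 0 \<le> (norm y)\<^sup>2 / (4 * C) - a * norm y" by linarith
      also have "\<dots> \<le> (g (x - t *\<^sub>R y) - g x) / t + W y"
        unfolding a_def using t by (intro increment_ge) auto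
      finally show ?thesis using L_ge[of x 0] \<epsilon> by simp
    qed
    then show "- L x - \<epsilon> \<le> D t x"
      using hopf_lax_ge[OF t(1)] \<epsilon> by (auto simp: D_def)
  qed
qed

lemma D_tendsto:
  assumes t: "t \<longlonglongrightarrow> 0" "\<And>k. 0 < t k"
  shows "(\<lambda>k. D (t k) x) \<longlonglongrightarrow> - L x"
proof (rule tendstoI)
  fix e :: real assume "0 < e"
  obtain \<delta> where \<delta>: "0 < \<delta>" "\<And>t. 0 < t \<Longrightarrow> t < \<delta> \<Longrightarrow> - L x - e / 2 \<le> D t x"
    using D_lower_limit[of "e / 2" x] \<open>0 < e\<close> by auto
  have "\<forall>\<^sub>F k in sequentially. t k < \<delta>"
    using t(1) \<delta>(1) by (rule order_tendstoD)
  then show "\<forall>\<^sub>F k in sequentially. dist (D (t k) x) (- L x) < e"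
  proof eventually_elim
    case (elim k)
    then have "- L x - e / 2 \<le> D (t k) x" "D (t k) x \<le> - L x"
      using \<delta>(2) t(2) by (auto simp: D_def)
    then show ?case using \<open>0 < e\<close> by (simp add: dist_real_def abs_if)
  qed
qed

lemma D_measurable: "0 < t \<Longrightarrow> D t \<in> borel_measurable borel"
  and L_measurable: "L \<in> borel_measurable borel"
proof -
  have "grad g \<in> borel_measurable borel"
    using C1_g by (auto simp: C1_def intro: borel_measurable_continuous_onI)
  from measurable_compose[OF this legendre_measurable[OF C_pos W_ge]]
  show [measurable]: "L \<in> borel_measurable borel"
    unfolding L_def[abs_def] .
  assume "0 < t"
  then have [measurable]: "hopf_lax W g t \<in> borel_measurable borel" "g \<in> borel_measurable borel"
    using hopf_lax_measurable[of g W t] g_pos W_pos C1_continuous_on[OF C1_g]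
    by (auto intro: borel_measurable_continuous_onI)
  show "D t \<in> borel_measurable borel"
    unfolding D_def[abs_def] by measurable
qed

text \<open>
  Enlarges \<open>K\<close> so that the upper bound \<open>W 0\<close> of the difference quotients is covered as well, using \<open>C g \<ge> 1\<close>.
\<close>

definition K' :: real where
  "K' = max K (C * W 0)"

lemma K'_pos: "0 < K'"
  using C_pos W_pos[of 0] by (simp add: K'_def less_max_iff_disj)

lemma abs_D_le:
  assumes t: "0 < t" "t \<le> 1 / (4 * C\<^sup>2)"
  shows "\<bar>D t x\<bar> \<le> K' * g x"
proof -
  have "K * g x \<le> K' * g x"
    using g_pos[of x] by (intro mult_right_mono) (auto simp: K'_def)
  moreover have "W 0 \<le> K' * g x"
  proof -
    have "1 / C * (0 + 1) \<le> g x"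
      using g_ge[of x] C_pos by (intro order_trans[OF _ g_ge[of x]] mult_left_mono) auto
    then have "W 0 * 1 \<le> W 0 * (C * g x)"
      using C_pos W_pos[of 0] by (intro mult_left_mono) (auto simp: field_simps)
    also have "\<dots> \<le> K' * g x"
      using g_pos[of x] by (simp add: K'_def mult_ac)
    finally show ?thesis by simp
  qed
  ultimately show ?thesis
    using D_ge[OF t, of x] D_le[of t x] by (simp add: abs_le_iff)
qed

text \<open>
  Relative to \<open>g\<close> the perturbation is \<open>s = t D / g\<close> with \<open>\<bar>s\<bar> \<le> t K' \<le> 1 / 2\<close>, so \<open>g + t D\<close> stays positive and
  its power \<open>- n\<close> is Lipschitz in \<open>s\<close>.
\<close>

lemma perturbation:
  assumes t: "0 < t" "t \<le> 1 / (4 * C\<^sup>2)" "t \<le> 1 / (2 * K')"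
  shows perturbation_pos: "0 < g x + t * D t x"
    and perturbation_bound: "\<bar>1 / (g x + t * D t x) ^ n - 1 / g x ^ n\<bar> \<le> t * (real n * 2 ^ n * (2 * K') * (1 / g x ^ n))"
proof -
  define s where "s = t * D t x / g x"
  have "\<bar>s\<bar> = t * (\<bar>D t x\<bar> / g x)"
    using t g_pos[of x] by (simp add: s_def abs_mult)
  also have "\<dots> \<le> t * K'"
    using abs_D_le[OF t(1,2), of x] t g_pos[of x] by (intro mult_left_mono) (auto simp: pos_divide_le_eq)
  finally have s: "\<bar>s\<bar> \<le> t * K'" .
  also have "t * K' \<le> 1 / 2"
    using t K'_pos by (simp add: field_simps)
  finally have s2: "1 / 2 \<le> 1 + s" by linarith
  have eq: "g x + t * D t x = g x * (1 + s)"
    using g_pos[of x] by (simp add: s_def field_simps)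
  show "0 < g x + t * D t x"
    unfolding eq using g_pos[of x] s2 by (intro mult_pos_pos) auto
  define a where "a = 1 / (1 + s)"
  have a: "0 \<le> a" "a \<le> 2"
    using s2 by (auto simp: a_def pos_divide_le_eq)
  have "a - 1 = - (a * s)" using s2 by (simp add: a_def field_simps)
  then have "\<bar>a - 1\<bar> = a * \<bar>s\<bar>" using a by (simp add: abs_mult)
  also have "\<dots> \<le> 2 * (t * K')"
    using a s by (intro mult_mono) auto
  finally have a1: "\<bar>a - 1\<bar> \<le> 2 * (t * K')" .
  have "1 / (g x + t * D t x) ^ n - 1 / g x ^ n = (a ^ n - 1) * (1 / g x ^ n)"
    unfolding eq a_def using g_pos[of x] by (simp add: power_mult_distrib power_one_over divide_simps)
  then have "\<bar>1 / (g x + t * D t x) ^ n - 1 / g x ^ n\<bar> = \<bar>a ^ n - 1\<bar> * (1 / g x ^ n)"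
    using g_pos[of x] by (simp add: abs_mult)
  also have "\<dots> \<le> (real n * 2 ^ n * (2 * (t * K'))) * (1 / g x ^ n)"
  proof (rule mult_right_mono)
    have "\<bar>a ^ n - 1\<bar> \<le> real n * 2 ^ n * \<bar>a - 1\<bar>" using a by (rule power_minus_one_le)
    also have "\<dots> \<le> real n * 2 ^ n * (2 * (t * K'))" using a1 by (intro mult_left_mono) auto
    finally show "\<bar>a ^ n - 1\<bar> \<le> real n * 2 ^ n * (2 * (t * K'))" .
  qed (use g_pos[of x] in auto)
  finally show "\<bar>1 / (g x + t * D t x) ^ n - 1 / g x ^ n\<bar> \<le> t * (real n * 2 ^ n * (2 * K') * (1 / g x ^ n))"
    by (simp add: mult_ac)
qed

text \<open>
  Since \<open>g + t D \<le> Q\<^sub>t g\<close>, the quotients \<open>((g + t D)\<^sup>-\<^sup>n - g\<^sup>-\<^sup>n) / t\<close> have nonnegative integrals. They are dominated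
  by a multiple of \<open>g\<^sup>-\<^sup>n\<close> and tend to \<open>n L / g\<^sup>n\<^sup>+\<^sup>1\<close>, which yields integrability of the limit as well.
\<close>

theorem comparison_inequality:
  assumes int_g: "(LINT x|lborel. 1 / g x ^ DIM('a)) = 1"
    and int_W: "(LINT x|lborel. 1 / W x ^ DIM('a)) = 1"
  shows comparison_integrable: "integrable lborel (\<lambda>x. L x / g x ^ (DIM('a) + 1))"
    and comparison_nonneg: "0 \<le> (LINT x|lborel. L x / g x ^ (DIM('a) + 1))"
proof -
  define n where "n = DIM('a)"
  have n: "0 < n" by (simp add: n_def)
  note [measurable] = D_measurable L_measurable
  have [measurable]: "g \<in> borel_measurable borel" "W \<in> borel_measurable borel"
    using C1_g C1_W by (auto intro!: borel_measurable_continuous_onI C1_continuous_on)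
  have integrable: "integrable lborel (\<lambda>x. 1 / g x ^ n)" "integrable lborel (\<lambda>x. 1 / W x ^ n)"
    using int_g int_W not_integrable_integral_eq unfolding n_def by fastforce+
  have nn: "(\<integral>\<^sup>+x. ennreal (1 / g x ^ n) \<partial>lborel) = 1" "(\<integral>\<^sup>+x. ennreal (1 / W x ^ n) \<partial>lborel) = 1"
    using int_g int_W nn_integral_eq_integral[OF integrable(1)] nn_integral_eq_integral[OF integrable(2)] g_pos W_pos
    by (simp_all add: n_def less_imp_le)
  define \<tau> where "\<tau> = min (1 / (4 * C\<^sup>2)) (1 / (2 * K'))"
  define t where "t k = \<tau> / Suc k" for k
  have \<tau>: "0 < \<tau>" using C_pos K'_pos by (simp add: \<tau>_def)
  have t: "0 < t k" "t k \<le> 1 / (4 * C\<^sup>2)" "t k \<le> 1 / (2 * K')" for k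
  proof -
    have "t k \<le> \<tau>" using \<tau> by (simp add: t_def divide_le_eq)
    then show "t k \<le> 1 / (4 * C\<^sup>2)" "t k \<le> 1 / (2 * K')" by (auto simp: \<tau>_def)
    show "0 < t k" using \<tau> by (simp add: t_def)
  qed
  have t_lim: "t \<longlonglongrightarrow> 0"
    unfolding t_def by (rule LIMSEQ_Suc[OF lim_const_over_n])
  define \<phi> where "\<phi> k x = (1 / (g x + t k * D (t k) x) ^ n - 1 / g x ^ n) / t k" for k x
  define w where "w x = real n * 2 ^ n * (2 * K') * (1 / g x ^ n)" for x
  have meas: "\<phi> k \<in> borel_measurable lborel" for k
    unfolding \<phi>_def using t(1)[of k] by measurable
  have meas_lim: "(\<lambda>x. real n * (L x / g x ^ (n + 1))) \<in> borel_measurable lborel"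
    by measurable
  have w: "integrable lborel w"
    unfolding w_def using integrable by (intro integrable_mult_right) auto
  have bound: "AE x in lborel. norm (\<phi> k x) \<le> w x" for k
    using t(1)[of k] perturbation_bound[OF t[of k]]
    by (simp add: \<phi>_def w_def pos_divide_le_eq mult.commute)
  have lim: "AE x in lborel. (\<lambda>k. \<phi> k x) \<longlonglongrightarrow> real n * (L x / g x ^ (n + 1))"
  proof (rule AE_I2)
    fix x
    have "((\<lambda>z. 1 / z ^ n) has_field_derivative - (n / g x ^ (n + 1))) (at (g x))"
      using g_pos[of x] n by (auto intro!: derivative_eq_intros simp: field_simps simp flip: power_Suc power_add)
    from difference_quotient_tendsto[OF this t_lim _ D_tendsto[OF t_lim t(1)]] t(1)
    show "(\<lambda>k. \<phi> k x) \<longlonglongrightarrow> real n * (L x / g x ^ (n + 1))"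
      by (simp add: \<phi>_def less_imp_neq[symmetric])
  qed
  have int_lim: "integrable lborel (\<lambda>x. real n * (L x / g x ^ (n + 1)))"
    by (rule integrable_dominated_convergence[OF meas_lim meas w lim bound])
  have conv: "(\<lambda>k. LINT x|lborel. \<phi> k x) \<longlonglongrightarrow> (LINT x|lborel. real n * (L x / g x ^ (n + 1)))"
    by (rule integral_dominated_convergence[OF meas_lim meas w lim bound])
  have "0 \<le> (LINT x|lborel. \<phi> k x)" for k
  proof -
    let ?q = "\<lambda>x. g x + t k * D (t k) x"
    have q: "0 < ?q x" "?q x \<le> hopf_lax W g (t k) x" for x
    proof -
      show "0 < ?q x" using t by (rule perturbation_pos)
      have "D (t k) x \<le> (hopf_lax W g (t k) x - g x) / t k"
        by (simp add: D_def)
      then show "?q x \<le> hopf_lax W g (t k) x"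
        using t(1)[of k] by (simp add: field_simps)
    qed
    have int_\<phi>: "integrable lborel (\<phi> k)"
    proof (rule Bochner_Integration.integrable_bound[OF w meas])
      show "AE x in lborel. norm (\<phi> k x) \<le> norm (w x)"
        using bound[of k] by eventually_elim simp
    qed
    have "integrable lborel (\<lambda>x. 1 / g x ^ n + t k * \<phi> k x)"
      using int_\<phi> integrable by auto
    moreover have eq: "1 / g x ^ n + t k * \<phi> k x = 1 / ?q x ^ n" for x
      using t(1)[of k] by (simp add: \<phi>_def)
    ultimately have int_q: "integrable lborel (\<lambda>x. 1 / ?q x ^ n)" by simp
    have "1 \<le> (\<integral>\<^sup>+x. ennreal (1 / hopf_lax W g (t k) x ^ n) \<partial>lborel)"
      using hopf_lax_integral_ge[of g W "t k"] g_pos W_pos t(1) less_le_trans[OF q]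
      by (simp add: C1_continuous_on C1_g C1_W nn[unfolded n_def] n_def)
    also have "\<dots> \<le> (\<integral>\<^sup>+x. ennreal (1 / ?q x ^ n) \<partial>lborel)"
      using q by (intro nn_integral_mono ennreal_leI divide_left_mono power_mono mult_pos_pos zero_less_power)
        (auto intro: less_imp_le less_le_trans)
    also have "\<dots> = ennreal (LINT x|lborel. 1 / ?q x ^ n)"
      using q by (intro nn_integral_eq_integral int_q) (auto simp: less_imp_le)
    finally have "1 \<le> (LINT x|lborel. 1 / ?q x ^ n)" by simp
    also have "\<dots> = 1 + t k * (LINT x|lborel. \<phi> k x)"
      unfolding eq[symmetric] using int_\<phi> integrable int_g by (simp add: n_def)
    finally show ?thesis using t(1)[of k] by (simp add: zero_le_mult_iff)
  qed
  then have "0 \<le> (LINT x|lborel. real n * (L x / g x ^ (n + 1)))"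
    by (intro LIMSEQ_le_const[OF conv]) auto
  also have "\<dots> = real n * (LINT x|lborel. L x / g x ^ (n + 1))"
    by (rule integral_mult_right_zero)
  finally show "0 \<le> (LINT x|lborel. L x / g x ^ (DIM('a) + 1))"
    using n by (simp add: n_def zero_le_mult_iff)
  show "integrable lborel (\<lambda>x. L x / g x ^ (DIM('a) + 1))"
  proof -
    have "integrable lborel (\<lambda>x. 1 / real n * (real n * (L x / g x ^ (n + 1))))"
      by (intro integrable_mult_right int_lim)
    moreover have "1 / real n * (real n * z) = z" for z using n by simp
    ultimately show ?thesis by (simp only: n_def)
  qed
qed

end

section \<open>The equality case\<close>

lemma strictly_convex_above_tangent:
  fixes W :: "'a::euclidean_space \<Rightarrow> real"
  assumes C1: "C1 W" and sc: "strictly_convex W"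
  shows "W x + (y - x) \<bullet> grad W x \<le> W y"
proof -
  define t where "t k = 1 / real (Suc (Suc k))" for k
  have t: "0 < t k" "t k < 1" for k by (auto simp: t_def)
  have t_lim: "t \<longlonglongrightarrow> 0"
    unfolding t_def by (intro LIMSEQ_Suc lim_const_over_n)
  have "((\<lambda>s. W (x + s *\<^sub>R (y - x))) has_field_derivative (y - x) \<bullet> grad W x) (at 0)"
  proof -
    have "((\<lambda>s. W (x + s *\<^sub>R (y - x))) has_derivative (\<lambda>h. (h *\<^sub>R (y - x)) \<bullet> grad W (x + 0 *\<^sub>R (y - x)))) (at 0)"
      by (rule has_derivative_compose[OF _ C1_has_derivative[OF C1]]) (auto intro!: derivative_eq_intros)
    then show ?thesis by (simp add: has_field_derivative_def mult_commute_abs)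
  qed
  from difference_quotient_tendsto[OF this t_lim, of "\<lambda>_. 1" 1] t(1)
  have "(\<lambda>k. (W (x + t k *\<^sub>R (y - x)) - W x) / t k) \<longlonglongrightarrow> (y - x) \<bullet> grad W x"
    by (simp add: less_imp_neq[symmetric])
  moreover have "(W (x + t k *\<^sub>R (y - x)) - W x) / t k \<le> W y - W x" for k
  proof (cases "x = y")
    case False
    have "W ((1 - t k) *\<^sub>R x + t k *\<^sub>R y) < (1 - t k) * W x + t k * W y"
      using sc False t[of k] unfolding strictly_convex_def by blast
    moreover have "(1 - t k) *\<^sub>R x + t k *\<^sub>R y = x + t k *\<^sub>R (y - x)"
      by (simp add: algebra_simps)
    ultimately have "W (x + t k *\<^sub>R (y - x)) \<le> (1 - t k) * W x + t k * W y" by simp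
    also have "\<dots> = (W y - W x) * t k + W x" by (simp add: algebra_simps)
    finally show ?thesis using t(1)[of k] by (simp add: pos_divide_le_eq)
  qed simp
  ultimately have "(y - x) \<bullet> grad W x \<le> W y - W x"
    by (intro LIMSEQ_le_const2) auto
  then show ?thesis by simp
qed

lemma legendre_grad:
  fixes W :: "'a::euclidean_space \<Rightarrow> real"
  assumes "C1 W" "strictly_convex W"
  shows "legendre W (grad W x) = ereal (x \<bullet> grad W x - W x)"
proof (rule antisym)
  have "grad W x \<bullet> y - W y \<le> x \<bullet> grad W x - W x" for y
    using strictly_convex_above_tangent[OF assms, of x y] by (simp add: inner_diff_left inner_commute[of "grad W x"])
  then show "legendre W (grad W x) \<le> ereal (x \<bullet> grad W x - W x)"
    unfolding legendre_def by (auto intro!: SUP_least)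
  show "ereal (x \<bullet> grad W x - W x) \<le> legendre W (grad W x)"
    unfolding legendre_def by (rule SUP_upper2[of x]) (auto simp: inner_commute)
qed

text \<open>
  The dilation by \<open>r\<close> contributes a factor \<open>r\<^sup>-\<^sup>n\<close>, which leaves \<open>\<integral> n / r dr\<close> over \<open>{1..2}\<close>. The weight
  \<open>n r\<^sup>n\<^sup>-\<^sup>1\<close> is the one in the derivative of \<open>r\<^sup>n W (r x)\<^sup>-\<^sup>n\<close>.
\<close>

lemma nn_integral_dilations:
  fixes u :: "'a::euclidean_space \<Rightarrow> real"
  assumes [measurable]: "u \<in> borel_measurable borel"
  shows "(\<integral>\<^sup>+x. (\<integral>\<^sup>+r. ennreal (DIM('a) * r ^ (DIM('a) - 1) * u (r *\<^sub>R x)) * indicator {1..2} r \<partial>lborel) \<partial>lborel)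
    = ennreal (DIM('a) * ln 2) * (\<integral>\<^sup>+x. ennreal (u x) \<partial>lborel)"
proof -
  let ?n = "DIM('a)"
  have "(\<integral>\<^sup>+x. (\<integral>\<^sup>+r. ennreal (?n * r ^ (?n - 1) * u (r *\<^sub>R x)) * indicator {1..2} r \<partial>lborel) \<partial>lborel)
      = (\<integral>\<^sup>+r. (\<integral>\<^sup>+x. ennreal (?n * r ^ (?n - 1) * u (r *\<^sub>R x)) * indicator {1..2} r \<partial>(lborel :: 'a measure)) \<partial>lborel)"
    by (rule lborel_pair.Fubini') measurable
  also have "\<dots> = (\<integral>\<^sup>+r. ennreal (?n / r) * indicator {1..2} r * (\<integral>\<^sup>+x. ennreal (u x) \<partial>lborel) \<partial>lborel)"
  proof (rule nn_integral_cong)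
    fix r :: real
    show "(\<integral>\<^sup>+x. ennreal (?n * r ^ (?n - 1) * u (r *\<^sub>R x)) * indicator {1..2} r \<partial>(lborel :: 'a measure))
      = ennreal (?n / r) * indicator {1..2} r * (\<integral>\<^sup>+x. ennreal (u x) \<partial>lborel)"
    proof (cases "r \<in> {1..2}")
      case True
      then have r: "0 < r" by auto
      have e: "real ?n * r ^ (?n - 1) = ?n / r * r ^ ?n"
        using r by (simp add: power_diff)
      have "(\<integral>\<^sup>+x. ennreal (?n * r ^ (?n - 1) * u (r *\<^sub>R x)) \<partial>lborel)
          = (\<integral>\<^sup>+x. ennreal (?n / r) * (ennreal (r ^ ?n) * ennreal (u (r *\<^sub>R x))) \<partial>lborel)"
      proof (rule nn_integral_cong)
        fix x
        have "0 \<le> ?n / r" "0 \<le> r ^ ?n" using r by auto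
        then show "ennreal (?n * r ^ (?n - 1) * u (r *\<^sub>R x)) = ennreal (?n / r) * (ennreal (r ^ ?n) * ennreal (u (r *\<^sub>R x)))"
          by (simp only: e mult.assoc ennreal_mult')
      qed
      also have "\<dots> = ennreal (?n / r) * (ennreal (r ^ ?n) * (\<integral>\<^sup>+x. ennreal (u (r *\<^sub>R x)) \<partial>lborel))"
        by (simp add: nn_integral_cmult)
      also have "\<dots> = ennreal (?n / r) * (\<integral>\<^sup>+x. ennreal (u x) \<partial>lborel)"
        using r by (subst nn_integral_lborel_scaleR) auto
      finally show ?thesis using True by simp
    qed simp
  qed
  also have "\<dots> = (\<integral>\<^sup>+r. ennreal (?n / r) * indicator {1..2} r \<partial>lborel) * (\<integral>\<^sup>+x. ennreal (u x) \<partial>lborel)"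
    by (rule nn_integral_multc) measurable
  also have "(\<integral>\<^sup>+r. ennreal (?n / r) * indicator {1..2} r \<partial>lborel) = ennreal (?n * ln 2 - ?n * ln 1)"
    by (rule nn_integral_FTC_Icc) (auto intro!: derivative_eq_intros)
  finally show ?thesis by simp
qed

lemma coercive_bounded_below:
  fixes W :: "'a::euclidean_space \<Rightarrow> real"
  assumes "continuous_on UNIV W" and pos: "\<And>x. 0 < W x" and "0 < C"
    and W: "\<And>x. W x \<ge> 1 / C * ((norm x)\<^sup>2 / 2)"
  obtains c where "0 < c" "\<And>x. c \<le> W x"
proof -
  obtain z where z: "\<And>x. norm x \<le> 1 \<Longrightarrow> W z \<le> W x"
  proof -
    have "\<exists>z\<in>cball (0::'a) 1. \<forall>x\<in>cball 0 1. W z \<le> W x"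
      by (rule continuous_attains_inf) (auto intro: continuous_on_subset[OF assms(1)])
    then show thesis using that by (auto simp: Ball_def)
  qed
  show thesis
  proof (rule that)
    show "0 < min (W z) (1 / C * (1 / 2))" using pos \<open>0 < C\<close> by simp
    fix x
    show "min (W z) (1 / C * (1 / 2)) \<le> W x"
    proof (cases "norm x \<le> 1")
      case False
      then have "1 / C * (1 / 2) \<le> 1 / C * ((norm x)\<^sup>2 / 2)"
        using \<open>0 < C\<close> by (intro mult_left_mono divide_right_mono) (auto simp: one_le_power)
      with W[of x] show ?thesis by linarith
    qed (auto intro: min.coboundedI1 z)
  qed
qed

text \<open>
  Let \<open>k\<close> be the integrand. Along a ray, \<open>W x\<^sup>-\<^sup>n - 2\<^sup>n W (2 x)\<^sup>-\<^sup>n\<close> is the integral of \<open>n r\<^sup>n\<^sup>-\<^sup>1 k (r x)\<close> over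
  \<open>{1..2}\<close>, and the two terms on the left have the same integral over \<open>x\<close>. The tangent inequality at the origin gives
  \<open>k \<ge> - k0\<close> with \<open>k0 = W 0 / W\<^sup>n\<^sup>+\<^sup>1\<close> integrable; adding \<open>k0\<close> makes all terms nonnegative, so the integrals over
  \<open>x\<close> and \<open>r\<close> may be exchanged before integrability of \<open>k\<close> is known.
\<close>

theorem convex_equality:
  fixes W :: "'a::euclidean_space \<Rightarrow> real"
  assumes C1: "C1 W" and pos: "\<And>x. 0 < W x" and sc: "strictly_convex W"
    and int_W: "(LINT x|lborel. 1 / W x ^ DIM('a)) = 1"
    and C: "0 < C" and W_ge: "\<And>x. W x \<ge> 1 / C * ((norm x)\<^sup>2 / 2)"
  shows "has_bochner_integral lborel (\<lambda>x. (x \<bullet> grad W x - W x) / W x ^ (DIM('a) + 1)) 0"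
proof -
  define n where "n = DIM('a)"
  have n: "0 < n" by (simp add: n_def)
  define k where "k x = (x \<bullet> grad W x - W x) / W x ^ (n + 1)" for x
  define k0 where "k0 x = W 0 / W x ^ (n + 1)" for x
  have cont: "continuous_on UNIV W" "continuous_on UNIV (grad W)"
    using C1 C1_continuous_on[OF C1] by (auto simp: C1_def)
  have [measurable]: "W \<in> borel_measurable borel" "grad W \<in> borel_measurable borel"
    using cont by (auto intro: borel_measurable_continuous_onI)
  have meas[measurable]: "k \<in> borel_measurable borel" "k0 \<in> borel_measurable borel"
    unfolding k_def k0_def by measurable
  have k0_nonneg: "0 \<le> k0 x" for x
    using pos[of 0] pos[of x] by (simp add: k0_def)
  have P_nonneg: "0 \<le> k x + k0 x" for x
  proof -
    have "0 \<le> (x \<bullet> grad W x - W x + W 0) / W x ^ (n + 1)"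
      using strictly_convex_above_tangent[OF C1 sc, of x 0] pos[of x] by (intro divide_nonneg_nonneg) (auto simp: less_imp_le)
    then show ?thesis by (simp add: k_def k0_def add_divide_distrib diff_divide_distrib)
  qed
  have int_rho: "integrable lborel (\<lambda>x. 1 / W x ^ n)"
    using int_W not_integrable_integral_eq unfolding n_def by fastforce
  have nn_rho: "(\<integral>\<^sup>+x. ennreal (1 / W x ^ n) \<partial>lborel) = 1"
    using int_W nn_integral_eq_integral[OF int_rho] pos by (simp add: n_def less_imp_le)
  obtain c where c: "0 < c" "\<And>x. c \<le> W x"
    using coercive_bounded_below[OF cont(1) pos C W_ge] by blast
  have int_k0: "integrable lborel k0"
  proof (rule Bochner_Integration.integrable_bound)
    show "integrable lborel (\<lambda>x. W 0 / c * (1 / W x ^ n))" by (intro integrable_mult_right int_rho)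
    have "k0 x \<le> W 0 / c * (1 / W x ^ n)" for x
      using c(1) c(2)[of x] pos[of x] pos[of 0] by (simp add: k0_def field_simps mult_left_mono)
    then show "AE x in lborel. norm (k0 x) \<le> norm (W 0 / c * (1 / W x ^ n))"
      by (intro AE_I2) (metis abs_ge_self abs_of_nonneg k0_nonneg order_trans real_norm_def)
  qed simp
  have ray: "ennreal (1 / W x ^ n) + (\<integral>\<^sup>+r. ennreal (n * r ^ (n - 1) * k0 (r *\<^sub>R x)) * indicator {1..2} r \<partial>lborel)
      = ennreal (2 ^ n * (1 / W (2 *\<^sub>R x) ^ n))
        + (\<integral>\<^sup>+r. ennreal (n * r ^ (n - 1) * (k (r *\<^sub>R x) + k0 (r *\<^sub>R x))) * indicator {1..2} r \<partial>lborel)" for x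
  proof -
    define F where "F r = - (r ^ n / W (r *\<^sub>R x) ^ n)" for r
    have dW: "((\<lambda>r. W (r *\<^sub>R x)) has_field_derivative x \<bullet> grad W (r *\<^sub>R x)) (at r)" for r
    proof -
      have "((\<lambda>r. W (r *\<^sub>R x)) has_derivative (\<lambda>h. (h *\<^sub>R x) \<bullet> grad W (r *\<^sub>R x))) (at r)"
        by (rule has_derivative_compose[OF _ C1_has_derivative[OF C1]]) (auto intro!: derivative_eq_intros)
      then show ?thesis by (simp add: has_field_derivative_def mult_commute_abs)
    qed
    have dF: "(F has_field_derivative n * r ^ (n - 1) * k (r *\<^sub>R x)) (at r)" for r :: real
    proof -
      obtain m where m: "n = Suc m" using n by (cases n) auto
      let ?w = "W (r *\<^sub>R x)" and ?d = "x \<bullet> grad W (r *\<^sub>R x)"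
      have w: "?w \<noteq> 0" using pos[of "r *\<^sub>R x"] by simp
      have "((\<lambda>r. r / W (r *\<^sub>R x)) has_field_derivative (?w - r * ?d) / (?w * ?w)) (at r)"
        using w by (auto intro!: derivative_eq_intros dW)
      from DERIV_minus[OF DERIV_power_Suc[OF this, of m]]
      have "(F has_field_derivative - ((1 + real m) * ((?w - r * ?d) / (?w * ?w) * (r / ?w) ^ m))) (at r)"
        unfolding F_def m power_divide by simp
      moreover have "- ((1 + real m) * ((?w - r * ?d) / (?w * ?w) * (r / ?w) ^ m)) = n * r ^ (n - 1) * k (r *\<^sub>R x)"
        using w by (simp add: m k_def power_divide field_simps)
      ultimately show ?thesis by simp
    qed
    have "((\<lambda>r. n * r ^ (n - 1) * k (r *\<^sub>R x)) has_integral F 2 - F 1) {1..2}"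
      using dF by (intro fundamental_theorem_of_calculus)
        (auto simp: has_real_derivative_iff_has_vector_derivative intro: has_vector_derivative_at_within)
    moreover
    define J where "J = integral {1..2} (\<lambda>r. n * r ^ (n - 1) * k0 (r *\<^sub>R x))"
    have J: "((\<lambda>r. n * r ^ (n - 1) * k0 (r *\<^sub>R x)) has_integral J) {1..2}"
      unfolding J_def k0_def using pos
      by (intro integrable_integral integrable_continuous_real continuous_intros continuous_on_compose2[OF cont(1)])
        (auto simp: less_imp_neq[symmetric])
    ultimately have "((\<lambda>r. n * r ^ (n - 1) * (k (r *\<^sub>R x) + k0 (r *\<^sub>R x))) has_integral F 2 - F 1 + J) {1..2}"
      unfolding distrib_left by (rule has_integral_add)
    then have PJ: "(\<integral>\<^sup>+r. ennreal (n * r ^ (n - 1) * (k (r *\<^sub>R x) + k0 (r *\<^sub>R x))) * indicator {1..2} r \<partial>lborel)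
        = ennreal (F 2 - F 1 + J)" and PJ0: "0 \<le> F 2 - F 1 + J"
      using P_nonneg by (auto intro!: nn_integral_has_integral_lebesgue' mult_nonneg_nonneg elim!: has_integral_nonneg)
    have J0: "0 \<le> J"
      using J k0_nonneg by (auto elim!: has_integral_nonneg)
    have "(\<integral>\<^sup>+r. ennreal (n * r ^ (n - 1) * k0 (r *\<^sub>R x)) * indicator {1..2} r \<partial>lborel) = ennreal J"
      using J k0_nonneg by (auto intro!: nn_integral_has_integral_lebesgue')
    then show ?thesis
      unfolding PJ using PJ0 J0 pos[of x] pos[of "2 *\<^sub>R x"]
      by (simp add: F_def less_imp_le flip: ennreal_plus)
  qed
  let ?K0 = "\<integral>\<^sup>+x. ennreal (k0 x) \<partial>lborel" and ?P = "\<integral>\<^sup>+x. ennreal (k x + k0 x) \<partial>lborel"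
  have "(\<integral>\<^sup>+x. ennreal (2 ^ n * (1 / W (2 *\<^sub>R x) ^ n)) \<partial>lborel) = 1"
  proof -
    have "(0::real) \<le> 2 ^ n" by simp
    then have "(\<integral>\<^sup>+x. ennreal (2 ^ n * (1 / W (2 *\<^sub>R x) ^ n)) \<partial>lborel)
        = (\<integral>\<^sup>+x. ennreal (2 ^ n) * ennreal (1 / W (2 *\<^sub>R x) ^ n) \<partial>lborel)"
      by (simp only: ennreal_mult')
    also have "\<dots> = ennreal (2 ^ n) * (\<integral>\<^sup>+x. ennreal (1 / W (2 *\<^sub>R x) ^ n) \<partial>lborel)"
      by (rule nn_integral_cmult) measurable
    also have "\<dots> = (\<integral>\<^sup>+x. ennreal (1 / W x ^ n) \<partial>lborel)"
      using nn_integral_lborel_scaleR[of "\<lambda>x. ennreal (1 / W x ^ n)" 2] by (simp add: n_def)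
    finally show ?thesis using nn_rho by simp
  qed
  then have "1 + ennreal (n * ln 2) * ?P
     = (\<integral>\<^sup>+x. (ennreal (2 ^ n * (1 / W (2 *\<^sub>R x) ^ n))
        + (\<integral>\<^sup>+r. ennreal (n * r ^ (n - 1) * (k (r *\<^sub>R x) + k0 (r *\<^sub>R x))) * indicator {1..2} r \<partial>lborel)) \<partial>lborel)"
    by (simp add: nn_integral_add nn_integral_dilations[of "\<lambda>x. k x + k0 x", folded n_def] del: One_nat_def)
  also have "\<dots> = 1 + ennreal (n * ln 2) * ?K0"
    unfolding ray[symmetric] by (simp add: nn_integral_add nn_integral_dilations[of k0, folded n_def] nn_rho del: One_nat_def)
  finally have "ennreal (n * ln 2) * ?P = ennreal (n * ln 2) * ?K0"
    by (simp add: ennreal_add_left_cancel)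
  then have P: "?P = ?K0"
    using n by (simp add: ennreal_mult_cancel_left)
  have "?K0 = ennreal (LINT x|lborel. k0 x)"
    using k0_nonneg by (intro nn_integral_eq_integral int_k0) auto
  with P have "has_bochner_integral lborel (\<lambda>x. k x + k0 x) (LINT x|lborel. k0 x)"
    using P_nonneg k0_nonneg by (intro has_bochner_integral_nn_integral) auto
  from has_bochner_integral_diff[OF this has_bochner_integral_integrable[OF int_k0]]
  show ?thesis by (simp add: k_def n_def)
qed

section \<open>The sharp inequality and its equality case\<close>

theorem theorem1p1:
  shows
    "(\<forall>(g :: real ^ 'n \<Rightarrow> real) (W :: real ^ 'n \<Rightarrow> real) C :: real.
        C1 g \<and> C1 W \<and> (\<forall>x. 0 < g x) \<and> (\<forall>x. 0 < W x)
        \<and> (LINT x|lborel. 1 / g x ^ CARD('n)) = 1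
        \<and> (LINT x|lborel. 1 / W x ^ CARD('n)) = 1
        \<and> 0 < C
        \<and> (\<forall>x. W x \<ge> 1 / C * ((norm x)\<^sup>2 / 2))
        \<and> (\<forall>x. 1 / C * ((norm x)\<^sup>2 + 1) \<le> g x \<and> g x \<le> C * ((norm x)\<^sup>2 + 1))
        \<and> (\<forall>x. norm (grad g x) \<le> C * (norm x + 1))
        \<longrightarrow>
        (\<forall>x. \<bar>legendre W (grad g x)\<bar> \<noteq> \<infinity>)
        \<and> integrable lborel (\<lambda>x. real_of_ereal (legendre W (grad g x)) / g x ^ (CARD('n) + 1))
        \<and> (LINT x|lborel. real_of_ereal (legendre W (grad g x)) / g x ^ (CARD('n) + 1)) \<ge> 0)
     \<and>
     (\<forall>(W :: real ^ 'n \<Rightarrow> real) C :: real.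
        C1 W \<and> (\<forall>x. 0 < W x) \<and> strictly_convex W
        \<and> (LINT x|lborel. 1 / W x ^ CARD('n)) = 1
        \<and> 0 < C
        \<and> (\<forall>x. W x \<ge> 1 / C * ((norm x)\<^sup>2 / 2))
        \<longrightarrow>
        (\<forall>x. \<bar>legendre W (grad W x)\<bar> \<noteq> \<infinity>)
        \<and> integrable lborel (\<lambda>x. real_of_ereal (legendre W (grad W x)) / W x ^ (CARD('n) + 1))
        \<and> (LINT x|lborel. real_of_ereal (legendre W (grad W x)) / W x ^ (CARD('n) + 1)) = 0)"
proof (intro conjI allI impI, goal_cases)
  case (1 g W C x)
  then show ?case by (intro legendre_finite[of C]) auto
next
  case (2 g W C)
  then interpret comparison g W C by unfold_locales auto
  show ?case using comparison_integrable 2 by (simp add: L_def)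
next
  case (3 g W C)
  then interpret comparison g W C by unfold_locales auto
  show ?case using comparison_nonneg 3 by (simp add: L_def)
next
  case (4 W C x)
  then show ?case by (simp add: legendre_grad)
next
  case (5 W C)
  then show ?case
    using convex_equality[of W C] by (simp add: legendre_grad has_bochner_integral_iff)
next
  case (6 W C)
  then show ?case
    using convex_equality[of W C] by (simp add: legendre_grad has_bochner_integral_iff)
qed

end
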